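(* Let $t>0$ and let $\Gamma=\partial B(0,r_0)$ be a circle in $\mathbb C$ with center at the origin and radius $r_0$. Then $\mu_\infty(M^3_{A\Gamma})=0$ for all $A\in U(2)$, where $M^3_{A\Gamma}$ carries the metric $h_t$.
   Context: Eguchi--Hanson space: $T^*\mathbb P^1(\mathbb C)$ is realized as $H^2=\{(\alpha,\beta,\gamma)\in(\mathbb C^2\setminus\{0\})\times\mathbb C\}/\sim$, where $(\alpha,\beta,\gamma)\sim(A\alpha,A\beta,\gamma/A^2)$ for $A\in\mathbb C^*$; the projection is $p([\alpha,\beta,\gamma])=\alpha/\beta\in\mathbb C\cup\{\infty\}=\mathbb P^1(\mathbb C)$. The complement of the zero section $\{\gamma=0\}$ is identified with $(\mathbb C^2\setminus\{0\})/\{\pm1\}$ by $[\alpha,\beta,\gamma]\mapsto \pm(z_1,z_2)=\pm(\alpha\sqrt\gamma,\beta\sqrt\gamma)$. Put $u_1=|z_1|^2+|z_2|^2$ and $f_t=\sqrt{u_1^2+t^4}+t^2\log\frac{u_1}{\sqrt{u_1^2+t^4}+t^2}$. The form $\omega_t=i\partial\bar\partial f_t$ extends to a Kähler form on $H^2$, and $g_t(X,Y)=\omega_t(X,JY)$ is the Eguchi--Hanson metric ($J$ the complex structure). For a curve $\Gamma$ in $\mathbb C\cup\{\infty\}$, $M^3_\Gamma=p^{-1}(\Gamma)\subset H^2$ with the metric $h_t$ induced by $g_t$. $U(2)$ acts on $\mathbb C\cup\{\infty\}$ by Möbius transforms $z\mapsto\frac{az+b}{cz+d}$, and $A\Gamma$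 is the image of $\Gamma$. Exponential growth of an open complete Riemannian manifold $M$: $\mu_\infty(M)=\limsup_{R\to\infty}\frac1R\log\mathrm{vol}(B_R(q_0))$, where $q_0\in M$ and $B_R(q_0)$ is the geodesic ball. *)

theory Defs
  imports "HOL-Analysis.Analysis"
begin

section \<open>The space \<open>H\<^sup>2\<close>, the total space of the cotangent bundle of the projective line\<close>

definition eh_rel :: "complex \<times> complex \<times> complex \<Rightarrow> complex \<times> complex \<times> complex \<Rightarrow> bool" where
  "eh_rel = (\<lambda>(\<alpha>, \<beta>, \<gamma>) (\<alpha>', \<beta>', \<gamma>').
     (\<alpha>, \<beta>) \<noteq> (0, 0) \<and> (\<alpha>', \<beta>') \<noteq> (0, 0) \<and>
     (\<exists>A. A \<noteq> 0 \<and> \<alpha>' = A * \<alpha> \<and> \<beta>' = A * \<beta> \<and> \<gamma>' = \<gamma> / A\<^sup>2))"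

lemma eh_rel_refl_iff: "eh_rel x x \<longleftrightarrow> (fst x, fst (snd x)) \<noteq> (0, 0)"
  by (auto simp: eh_rel_def split: prod.splits intro!: exI[of _ 1])

lemma part_equivp_eh_rel: "part_equivp eh_rel"
proof (rule part_equivpI)
  show "\<exists>x. eh_rel x x"
    by (rule exI[of _ "(1, 0, 0)"]) (simp add: eh_rel_refl_iff)
  show "symp eh_rel"
  proof (rule sympI)
    fix x y assume "eh_rel x y"
    then obtain A where A: "A \<noteq> 0" "fst y = A * fst x" "fst (snd y) = A * fst (snd x)"
      "snd (snd y) = snd (snd x) / A\<^sup>2" "(fst x, fst (snd x)) \<noteq> (0, 0)"
      "(fst y, fst (snd y)) \<noteq> (0, 0)"
      by (auto simp: eh_rel_def split: prod.splits)
    then show "eh_rel y x"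
      by (auto simp: eh_rel_def power_divide split: prod.splits intro!: exI[of _ "1 / A"])
  qed
  show "transp eh_rel"
  proof (rule transpI)
    fix x y z assume "eh_rel x y" "eh_rel y z"
    then obtain A B where "A \<noteq> 0" "fst y = A * fst x" "fst (snd y) = A * fst (snd x)"
      "snd (snd y) = snd (snd x) / A\<^sup>2" "(fst x, fst (snd x)) \<noteq> (0, 0)"
      "B \<noteq> 0" "fst z = B * fst y" "fst (snd z) = B * fst (snd y)"
      "snd (snd z) = snd (snd y) / B\<^sup>2" "(fst z, fst (snd z)) \<noteq> (0, 0)"
      by (auto simp: eh_rel_def split: prod.splits)
    then show "eh_rel x z"
      by (auto simp: eh_rel_def power_mult_distrib mult_ac split: prod.splits intro!: exI[of _ "B * A"])
  qed
qed

quotient_type h2 = "complex \<times> complex \<times> complex" / partial: eh_rel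
  by (rule part_equivp_eh_rel)

text \<open>\<open>H\<^sup>2\<close> carries the quotient topology; the set of valid triples is open.\<close>

instantiation h2 :: topological_space
begin

definition open_h2 :: "h2 set \<Rightarrow> bool" where
  "open_h2 U \<longleftrightarrow> open {x. eh_rel x x \<and> abs_h2 x \<in> U}"

instance
proof
  have "open (- ({0 :: complex} \<times> {0 :: complex} \<times> (UNIV :: complex set)))"
    by (intro open_Compl closed_Times) auto
  also have "- ({0 :: complex} \<times> {0 :: complex} \<times> (UNIV :: complex set)) = {x. eh_rel x x}"
    by (auto simp: eh_rel_refl_iff)
  finally show "open (UNIV :: h2 set)"
    by (simp add: open_h2_def)
  show "open (S \<inter> T)" if "open S" "open T" for S T :: "h2 set"
  proof -
    have "{x. eh_rel x x \<and> abs_h2 x \<in> S \<inter> T} =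
          {x. eh_rel x x \<and> abs_h2 x \<in> S} \<inter> {x. eh_rel x x \<and> abs_h2 x \<in> T}"
      by auto
    then show ?thesis
      using that by (simp add: open_h2_def open_Int)
  qed
  show "open (\<Union>K)" if "\<forall>S\<in>K. open S" for K :: "h2 set set"
  proof -
    have "{x. eh_rel x x \<and> abs_h2 x \<in> \<Union>K} = (\<Union>S\<in>K. {x. eh_rel x x \<and> abs_h2 x \<in> S})"
      by auto
    then show ?thesis
      using that by (auto simp: open_h2_def intro!: open_UN)
  qed
qed

end

text \<open>\<open>\<complex> \<union> {\<infinity>}\<close> is modelled by \<^typ>\<open>complex option\<close>, with \<^term>\<open>None\<close> as \<open>\<infinity>\<close>.\<close>

lift_definition eh_proj :: "h2 \<Rightarrow> complex option" is
  "\<lambda>(\<alpha>, \<beta>, \<gamma>). if \<beta> = 0 then None else Some (\<alpha> / \<beta>)"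
  by (auto simp: eh_rel_def)

text \<open>Off the zero section, \<open>eh_u\<close> is \<open>\<bar>z\<^sub>1\<bar>\<^sup>2 + \<bar>z\<^sub>2\<bar>\<^sup>2\<close> with
  \<open>\<plusminus>(z\<^sub>1, z\<^sub>2) = \<plusminus>(\<alpha> \<surd>\<gamma>, \<beta> \<surd>\<gamma>)\<close>.\<close>

lift_definition eh_u :: "h2 \<Rightarrow> real" is
  "\<lambda>(\<alpha>, \<beta>, \<gamma>). (cmod (\<alpha> * csqrt \<gamma>))\<^sup>2 + (cmod (\<beta> * csqrt \<gamma>))\<^sup>2"
  by (auto simp: eh_rel_def norm_mult norm_divide norm_power power_mult_distrib)


section \<open>Holomorphic atlas\<close>

text \<open>The two standard trivialisations: \<open>Aff\<close> is defined over \<open>\<complex>\<close> (that is, \<open>\<beta> \<noteq> 0\<close>) with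
  inverse \<open>(z, w) \<mapsto> [z, 1, w]\<close>, and \<open>AtInf\<close> over the complement of \<open>0\<close> (that is, \<open>\<alpha> \<noteq> 0\<close>)
  with inverse \<open>(z, w) \<mapsto> [1, z, w]\<close>. In both, the zero section is \<open>w = 0\<close>.\<close>

datatype eh_index = Aff | AtInf

fun eh_dom :: "eh_index \<Rightarrow> h2 set" where
  "eh_dom Aff = {q. eh_proj q \<noteq> None}"
| "eh_dom AtInf = {q. eh_proj q \<noteq> Some 0}"

lift_definition eh_chart :: "eh_index \<Rightarrow> h2 \<Rightarrow> complex ^ 2" is
  "\<lambda>k (\<alpha>, \<beta>, \<gamma>). case k of Aff \<Rightarrow> vector [\<alpha> / \<beta>, \<gamma> * \<beta>\<^sup>2] | AtInf \<Rightarrow> vector [\<beta> / \<alpha>, \<gamma> * \<alpha>\<^sup>2]"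
  by (auto simp: eh_rel_def power_mult_distrib split: eh_index.splits)

fun eh_point :: "eh_index \<Rightarrow> complex ^ 2 \<Rightarrow> h2" where
  "eh_point Aff p = abs_h2 (p $ 1, 1, p $ 2)"
| "eh_point AtInf p = abs_h2 (1, p $ 1, p $ 2)"

text \<open>A chart around each point, used to evaluate chart-independent quantities.\<close>

definition eh_index_at :: "h2 \<Rightarrow> eh_index" where
  "eh_index_at q = (case eh_proj q of None \<Rightarrow> AtInf | Some z \<Rightarrow> if cmod z \<le> 1 then Aff else AtInf)"


section \<open>The Eguchi--Hanson metric\<close>

definition wirtinger :: "2 \<Rightarrow> (complex ^ 2 \<Rightarrow> complex) \<Rightarrow> complex ^ 2 \<Rightarrow> complex" where
  "wirtinger j F p = (frechet_derivative F (at p) (axis j 1) - \<i> * frechet_derivative F (at p) (axis j \<i>)) / 2"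

definition wirtinger_bar :: "2 \<Rightarrow> (complex ^ 2 \<Rightarrow> complex) \<Rightarrow> complex ^ 2 \<Rightarrow> complex" where
  "wirtinger_bar j F p = (frechet_derivative F (at p) (axis j 1) + \<i> * frechet_derivative F (at p) (axis j \<i>)) / 2"

text \<open>The real \<open>(1,1)\<close>-form \<open>i \<partial>\<partial>bar f = i \<Sum>\<^sub>j\<^sub>l (\<partial>\<^sub>j \<partial>bar\<^sub>l f) dz\<^sub>j \<and> dzbar\<^sub>l\<close>, where
  \<open>(dz\<^sub>j \<and> dzbar\<^sub>l)(X, Y) = dz\<^sub>j(X) dzbar\<^sub>l(Y) - dz\<^sub>j(Y) dzbar\<^sub>l(X)\<close>.\<close>

definition i_ddbar :: "(complex ^ 2 \<Rightarrow> real) \<Rightarrow> complex ^ 2 \<Rightarrow> complex ^ 2 \<Rightarrow> complex ^ 2 \<Rightarrow> real" where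
  "i_ddbar f p X Y = Re (\<i> * (\<Sum>j\<in>UNIV. \<Sum>l\<in>UNIV.
     wirtinger j (wirtinger_bar l (\<lambda>q. complex_of_real (f q))) p *
       (X $ j * cnj (Y $ l) - Y $ j * cnj (X $ l))))"

text \<open>The potential; only its values off the zero section are meaningful.\<close>

definition eh_potential :: "real \<Rightarrow> h2 \<Rightarrow> real" where
  "eh_potential t q = sqrt ((eh_u q)\<^sup>2 + t ^ 4) +
     t\<^sup>2 * ln (eh_u q / (sqrt ((eh_u q)\<^sup>2 + t ^ 4) + t\<^sup>2))"

text \<open>\<open>\<omega>\<^sub>t\<close> in the coordinates of a chart, extended continuously over the zero section.\<close>

definition eh_omega :: "real \<Rightarrow> eh_index \<Rightarrow> complex ^ 2 \<Rightarrow> complex ^ 2 \<Rightarrow> complex ^ 2 \<Rightarrow> real" where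
  "eh_omega t k p X Y =
     (if p $ 2 \<noteq> 0 then i_ddbar (eh_potential t \<circ> eh_point k) p X Y
      else Lim (at p within {q. q $ 2 \<noteq> 0}) (\<lambda>q. i_ddbar (eh_potential t \<circ> eh_point k) q X Y))"

definition eh_metric :: "real \<Rightarrow> eh_index \<Rightarrow> complex ^ 2 \<Rightarrow> complex ^ 2 \<Rightarrow> complex ^ 2 \<Rightarrow> real" where
  "eh_metric t k p X Y = eh_omega t k p X (\<i> *s Y)"


section \<open>Maps into \<open>H\<^sup>2\<close>\<close>

definition C1_on :: "('a::real_normed_vector \<Rightarrow> 'b::real_normed_vector) \<Rightarrow> 'a set \<Rightarrow> bool" where
  "C1_on f W \<longleftrightarrow> open W \<and>
     (\<exists>D :: 'a \<Rightarrow> 'a \<Rightarrow>\<^sub>L 'b. (\<forall>x\<in>W. (f has_derivative blinfun_apply (D x)) (at x)) \<and> continuous_on W D)"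

definition eh_C1_on :: "('a::real_normed_vector \<Rightarrow> h2) \<Rightarrow> 'a set \<Rightarrow> bool" where
  "eh_C1_on \<phi> W \<longleftrightarrow> open W \<and> continuous_on W \<phi> \<and>
     (\<forall>k. C1_on (eh_chart k \<circ> \<phi>) {x \<in> W. \<phi> x \<in> eh_dom k})"

definition eh_deriv :: "('a::real_normed_vector \<Rightarrow> h2) \<Rightarrow> 'a \<Rightarrow> 'a \<Rightarrow> complex ^ 2" where
  "eh_deriv \<phi> x = frechet_derivative (eh_chart (eh_index_at (\<phi> x)) \<circ> \<phi>) (at x)"

text \<open>The pull-back \<open>\<phi>\<^sup>* g\<^sub>t\<close>. For \<open>\<phi>\<close> with values in a submanifold \<open>M\<close> it is also the pull-back of
  the metric induced on \<open>M\<close>.\<close>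

definition eh_pullback :: "real \<Rightarrow> ('a::real_normed_vector \<Rightarrow> h2) \<Rightarrow> 'a \<Rightarrow> 'a \<Rightarrow> 'a \<Rightarrow> real" where
  "eh_pullback t \<phi> x v w =
     eh_metric t (eh_index_at (\<phi> x)) (eh_chart (eh_index_at (\<phi> x)) (\<phi> x)) (eh_deriv \<phi> x v) (eh_deriv \<phi> x w)"


section \<open>Distance, volume and growth of a submanifold \<open>M\<close> with the induced metric\<close>

definition eh_curve :: "(real \<Rightarrow> h2) \<Rightarrow> bool" where
  "eh_curve c \<longleftrightarrow> path c \<and> (\<exists>F. finite F \<and> eh_C1_on c ({0<..<1} - F))"

definition eh_length :: "real \<Rightarrow> (real \<Rightarrow> h2) \<Rightarrow> ennreal" where
  "eh_length t c = (\<integral>\<^sup>+s\<in>{0..1}. ennreal (sqrt (eh_pullback t c s 1 1)) \<partial>lborel)"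

definition eh_dist :: "real \<Rightarrow> h2 set \<Rightarrow> h2 \<Rightarrow> h2 \<Rightarrow> ennreal" where
  "eh_dist t M q q' =
     (INF c \<in> {c. eh_curve c \<and> path_image c \<subseteq> M \<and> pathstart c = q \<and> pathfinish c = q'}. eh_length t c)"

definition eh_ball :: "real \<Rightarrow> h2 set \<Rightarrow> h2 \<Rightarrow> real \<Rightarrow> h2 set" where
  "eh_ball t M q R = {q' \<in> M. eh_dist t M q q' < ennreal R}"

text \<open>Local parametrisations of a three-dimensional submanifold.\<close>

definition eh_parametrization :: "h2 set \<Rightarrow> (real ^ 3 \<Rightarrow> h2) \<Rightarrow> (real ^ 3) set \<Rightarrow> bool" where
  "eh_parametrization M \<phi> U \<longleftrightarrow> eh_C1_on \<phi> U \<and> \<phi> ` U \<subseteq> M \<and> inj_on \<phi> U \<and> (\<forall>x\<in>U. inj (eh_deriv \<phi> x))"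

definition eh_volume_density :: "real \<Rightarrow> (real ^ 3 \<Rightarrow> h2) \<Rightarrow> real ^ 3 \<Rightarrow> real" where
  "eh_volume_density t \<phi> x =
     sqrt (det ((\<chi> i j. eh_pullback t \<phi> x (axis i 1) (axis j 1)) :: real ^ 3 ^ 3))"

text \<open>The Riemannian volume: \<open>\<phi> ` K\<close> has volume \<open>\<integral>\<^sub>K \<surd>(det \<phi>\<^sup>* g\<^sub>t)\<close> for every parametrised Borel
  piece \<open>\<phi> ` K\<close>, and a general set is covered by countably many such pieces (pieces may be
  empty). On Borel sets the infimum is attained by partitions into parametrised pieces.\<close>

definition eh_volume :: "real \<Rightarrow> h2 set \<Rightarrow> h2 set \<Rightarrow> ennreal" where
  "eh_volume t M B = Inf {(\<Sum>n. \<integral>\<^sup>+x\<in>K n. ennreal (eh_volume_density t (\<phi> n) x) \<partial>lborel) | \<phi> U K.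
     (\<forall>n :: nat. eh_parametrization M (\<phi> n) (U n) \<and> K n \<in> sets borel \<and> K n \<subseteq> U n) \<and>
     B \<subseteq> (\<Union>n. \<phi> n ` K n)}"

text \<open>Extended logarithm, so that infinite volume is not assigned growth \<open>0\<close>.\<close>

definition ext_ln :: "ennreal \<Rightarrow> ereal" where
  "ext_ln v = (if v = 0 then - \<infinity> else if v = top then \<infinity> else ereal (ln (enn2real v)))"

definition eh_exp_growth :: "real \<Rightarrow> h2 set \<Rightarrow> h2 \<Rightarrow> ereal" where
  "eh_exp_growth t M q = Limsup at_top (\<lambda>R :: real. ext_ln (eh_volume t M (eh_ball t M q R)) / ereal R)"


section \<open>The submanifolds \<open>M\<^sup>3\<^sub>\<Gamma>\<close> and the action of \<open>U(2)\<close>\<close>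

definition M3 :: "complex option set \<Rightarrow> h2 set" where
  "M3 \<Gamma> = eh_proj -` \<Gamma>"

definition U2 :: "(complex ^ 2 ^ 2) set" where
  "U2 = {A. A ** (\<chi> i j. cnj (A $ j $ i)) = mat 1 \<and> (\<chi> i j. cnj (A $ j $ i)) ** A = mat 1}"

fun moebius :: "complex ^ 2 ^ 2 \<Rightarrow> complex option \<Rightarrow> complex option" where
  "moebius A None = (if A $ 2 $ 1 = 0 then None else Some (A $ 1 $ 1 / A $ 2 $ 1))"
| "moebius A (Some z) =
     (if A $ 2 $ 1 * z + A $ 2 $ 2 = 0 then None
      else Some ((A $ 1 $ 1 * z + A $ 1 $ 2) / (A $ 2 $ 1 * z + A $ 2 $ 2)))"

end

theory Submission
  imports Defs "HOL-Real_Asymp.Real_Asymp"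
begin

text \<open>
  Write \<open>u = u\<^sub>1\<close> and \<open>S = \<surd>(u\<^sup>2 + t\<^sup>4)\<close>. As a function of \<open>s = log u\<close> the potential satisfies
  \<open>df\<^sub>t/ds = S\<close>, whence \<open>\<partial>\<partial>bar f\<^sub>t = S \<partial>\<partial>bar s + (u\<^sup>2/S) \<partial>s \<and> \<partial>bar s\<close>, and the metric
  is \<open>2 S |P|\<^sup>2 + (2/S) |Q|\<^sup>2\<close> for two explicit linear forms \<open>P\<close>, \<open>Q\<close>.

  The function \<open>\<surd>S\<close> is Lipschitz with constant 1, so \<open>u\<close> grows at most quadratically in the distance.
  With \<open>A = (a, b; c, d)\<close> and \<open>\<zeta> = r\<^sub>0 exp(i\<theta>)\<close>, the submanifold is parametrised by
  \<open>(\<theta>, \<gamma>) \<mapsto> [a\<zeta> + b, c\<zeta> + d, \<gamma>]\<close>. Because \<open>A\<close> is unitary, \<open>u = (1 + r\<^sub>0\<^sup>2) |\<gamma>|\<close>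
  and the volume density is \<open>r\<^sub>0 (1 + r\<^sub>0\<^sup>2) / \<surd>(2 S)\<close>, which is bounded. Hence the volume of
  balls grows at most polynomially. It also stays away from zero: for an arbitrary covering by
  parametrised pieces, this follows by comparing each piece with the parametrisation above
  through the change of variables formula.
\<close>

section \<open>Coordinates on the quotient\<close>

text \<open>\<open>ext_ln\<close> sends volume 0 to minus infinity, so growth 0 needs a positive
  lower bound on the volume of balls besides the polynomial upper one. The two differ in difficulty
  because \<open>eh_volume\<close> is an infimum over coverings: one explicit covering settles the
  upper bound, whereas the lower bound has to face every covering. The obstacle is the zero section,
  where u is not smooth and the metric is given as a limit. Hence the use of u^2 and of linear forms
  free of division by the fibre coordinate: curves and parametrised pieces may then cross the zero
  section. Unitarity enters through orthonormal columns. They make the homogeneous vector of the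
  parametrisation one of constant norm, and the metric in the parameters \<theta>, \<gamma> no
  longer contains the entries of A. The upper bound is deliberately crude: a ball of radius R fits
  into the image of a parameter cube with sides of order R^2, so its volume is at most of order
  R^6.\<close>

lemma abs_h2_eq_iff:
  assumes "eh_rel x x" "eh_rel y y"
  shows "abs_h2 x = abs_h2 y \<longleftrightarrow> eh_rel x y"
  using assms by (metis Quotient3_h2 Quotient3_rel)

lemma h2_cases:
  obtains \<alpha> \<beta> \<gamma> where "q = abs_h2 (\<alpha>, \<beta>, \<gamma>)" "\<alpha> \<noteq> 0 \<or> \<beta> \<noteq> 0"
proof (induct q rule: h2.abs_induct)
  case (1 y)
  then show ?case
    by (cases y) (auto simp: eh_rel_refl_iff)
qed

lemma eh_chart_abs:
  assumes "\<alpha> \<noteq> 0 \<or> \<beta> \<noteq> 0"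
  shows "eh_chart Aff (abs_h2 (\<alpha>, \<beta>, \<gamma>)) = vector [\<alpha> / \<beta>, \<gamma> * \<beta>\<^sup>2]"
    and "eh_chart AtInf (abs_h2 (\<alpha>, \<beta>, \<gamma>)) = vector [\<beta> / \<alpha>, \<gamma> * \<alpha>\<^sup>2]"
  using assms by (auto simp: eh_chart.abs_eq eh_rel_refl_iff)

lemma eh_proj_abs:
  assumes "\<alpha> \<noteq> 0 \<or> \<beta> \<noteq> 0"
  shows "eh_proj (abs_h2 (\<alpha>, \<beta>, \<gamma>)) = (if \<beta> = 0 then None else Some (\<alpha> / \<beta>))"
  using assms by (simp add: eh_proj.abs_eq eh_rel_refl_iff)

lemma eh_u_abs:
  assumes "\<alpha> \<noteq> 0 \<or> \<beta> \<noteq> 0"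
  shows "eh_u (abs_h2 (\<alpha>, \<beta>, \<gamma>)) = cmod \<gamma> * ((cmod \<alpha>)\<^sup>2 + (cmod \<beta>)\<^sup>2)"
  using assms
  by (simp add: eh_u.abs_eq eh_rel_refl_iff norm_mult power_mult_distrib algebra_simps
      flip: norm_power)

lemma eh_index_at_dom: "q \<in> eh_dom (eh_index_at q)"
  by (auto simp: eh_index_at_def split: option.splits)

lemma eh_dom_abs:
  assumes "\<alpha> \<noteq> 0 \<or> \<beta> \<noteq> 0"
  shows "abs_h2 (\<alpha>, \<beta>, \<gamma>) \<in> eh_dom Aff \<longleftrightarrow> \<beta> \<noteq> 0"
    and "abs_h2 (\<alpha>, \<beta>, \<gamma>) \<in> eh_dom AtInf \<longleftrightarrow> \<alpha> \<noteq> 0"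
  using assms by (auto simp: eh_proj_abs split: if_splits)

section \<open>Topology of the quotient\<close>

lemma open_valid: "open {x. eh_rel x x}"
proof -
  have "{x. eh_rel x x} = {x :: complex \<times> complex \<times> complex. fst x \<noteq> 0} \<union> {x. fst (snd x) \<noteq> 0}"
    by (auto simp: eh_rel_refl_iff)
  also have "open \<dots>"
    by (intro open_Un open_Collect_neq continuous_intros)
  finally show ?thesis .
qed

lemma continuous_on_abs_h2: "continuous_on {x. eh_rel x x} abs_h2"
  unfolding continuous_on_open_vimage[OF open_valid]
  by (auto simp: open_h2_def vimage_def Int_def conj_commute)

text \<open>Universal property of the quotient topology: continuity on \<open>h2\<close> is tested
  on representatives.\<close>

lemma open_vimage_h2I:
  fixes g :: "h2 \<Rightarrow> 'b::topological_space"
  assumes "continuous_on {x. eh_rel x x} (g \<circ> abs_h2)" "open V"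
  shows "open (g -` V)"
proof -
  have "open ((g \<circ> abs_h2) -` V \<inter> {x. eh_rel x x})"
    using assms open_valid continuous_on_open_vimage by blast
  moreover have "(g \<circ> abs_h2) -` V \<inter> {x. eh_rel x x} = {x. eh_rel x x \<and> abs_h2 x \<in> g -` V}"
    by auto
  ultimately show ?thesis
    by (simp add: open_h2_def)
qed

lemma continuous_on_eh_u: "continuous_on A eh_u"
proof -
  have "continuous_on {x. eh_rel x x} (\<lambda>x. cmod (snd (snd x)) * ((cmod (fst x))\<^sup>2 + (cmod (fst (snd x)))\<^sup>2))"
    by (intro continuous_intros)
  also have "?this \<longleftrightarrow> continuous_on {x. eh_rel x x} (eh_u \<circ> abs_h2)"
    by (intro continuous_on_cong refl) (auto simp: eh_rel_refl_iff eh_u_abs)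
  finally have "continuous_on UNIV eh_u"
    using open_vimage_h2I[of eh_u] by (auto simp: continuous_on_open_vimage)
  then show ?thesis
    using continuous_on_subset by blast
qed

lemma open_eh_dom: "open (eh_dom k)"
proof -
  have "{x. eh_rel x x \<and> abs_h2 x \<in> eh_dom k} = {x. eh_rel x x} \<inter> {x. (case k of Aff \<Rightarrow> fst (snd x) | AtInf \<Rightarrow> fst x) \<noteq> 0}"
    by (cases k) (auto simp: eh_rel_refl_iff eh_proj_abs split: if_splits)
  also have "open \<dots>"
    by (cases k; simp; intro open_Int open_valid open_Collect_neq continuous_intros)
  finally show ?thesis
    by (simp add: open_h2_def)
qed

text \<open>In both charts \<open>|z\<^sub>1|\<^sup>2 + |z\<^sub>2|\<^sup>2 = |w| (1 + |z|\<^sup>2)\<close>; its square, unlike \<open>eh_u\<close> itself, is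
  smooth across the zero section.\<close>

definition usq :: "complex ^ 2 \<Rightarrow> real" where
  "usq p = (cmod (p $ 2))\<^sup>2 * (1 + (cmod (p $ 1))\<^sup>2)\<^sup>2"

definition eh_S :: "real \<Rightarrow> h2 \<Rightarrow> real" where
  "eh_S t q = sqrt ((eh_u q)\<^sup>2 + t ^ 4)"

lemma eh_u_point: "eh_u (eh_point k p) = cmod (p $ 2) * (1 + (cmod (p $ 1))\<^sup>2)"
  by (cases k) (simp_all add: eh_u_abs)

lemma eh_u_chart:
  assumes "q \<in> eh_dom k"
  shows "(eh_u q)\<^sup>2 = usq (eh_chart k q)"
proof -
  have *: "(c * (a\<^sup>2 + b\<^sup>2))\<^sup>2 = (c * b\<^sup>2)\<^sup>2 * (1 + (a / b)\<^sup>2)\<^sup>2" if "b \<noteq> 0" for a b c :: real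
  proof -
    have "a\<^sup>2 + b\<^sup>2 = b\<^sup>2 * (1 + (a / b)\<^sup>2)"
      using that by (simp add: field_simps)
    then show ?thesis
      by (simp add: power_mult_distrib)
  qed
  obtain \<alpha> \<beta> \<gamma> where q: "q = abs_h2 (\<alpha>, \<beta>, \<gamma>)" "\<alpha> \<noteq> 0 \<or> \<beta> \<noteq> 0"
    by (rule h2_cases)
  show ?thesis
    using q(2) assms *[of "cmod \<beta>" "cmod \<gamma>" "cmod \<alpha>"] *[of "cmod \<alpha>" "cmod \<gamma>" "cmod \<beta>"]
    unfolding q(1)
    by (cases k)
       (simp_all only: eh_dom_abs eh_u_abs eh_chart_abs usq_def vector_2 norm_mult norm_divide
          norm_power norm_eq_zero add.commute[of "(cmod \<beta>)\<^sup>2"] not_False_eq_True simp_thms)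
qed

text \<open>The Fubini-Study part: |\<open>eh_P\<close>|^2 is the complex Hessian of log (1 +
  |z|^2), and log |w|, the other summand of log u, is pluriharmonic.\<close>

definition eh_P :: "complex ^ 2 \<Rightarrow> complex ^ 2 \<Rightarrow> complex" where
  "eh_P p X = X $ 1 / (1 + p $ 1 * cnj (p $ 1))"

text \<open>For w \<noteq> 0 this is w (1 + |z|^2) times the (1,0)-part of d log u. Clearing the
  denominator removes the pole at w = 0, and the modulus becomes u times that of the
  (1,0)-part.\<close>

definition eh_Q :: "complex ^ 2 \<Rightarrow> complex ^ 2 \<Rightarrow> complex" where
  "eh_Q p X = (1 + p $ 1 * cnj (p $ 1)) * X $ 2 / 2 + p $ 2 * cnj (p $ 1) * X $ 1"

text \<open>The factors 2 stem from Re (i (T - cnj T)) = -2 Im T, where T is the Hermitian form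
  behind the (1,1)-form. The inner product of complex numbers is Re (a cnj b).\<close>

definition eh_form :: "real \<Rightarrow> complex ^ 2 \<Rightarrow> complex ^ 2 \<Rightarrow> complex ^ 2 \<Rightarrow> real" where
  "eh_form t p X Y = 2 * sqrt (usq p + t ^ 4) * (eh_P p X \<bullet> eh_P p Y)
     + 2 / sqrt (usq p + t ^ 4) * (eh_Q p X \<bullet> eh_Q p Y)"

section \<open>Real derivatives and Wirtinger derivatives\<close>

lemma has_derivative_nth [derivative_intros]:
  "(f has_derivative f') F \<Longrightarrow> ((\<lambda>x. f x $ i) has_derivative (\<lambda>h. f' h $ i)) F"
  by (rule bounded_linear.has_derivative[OF bounded_linear_vec_nth])

lemma has_derivative_ln_gen:
  assumes "(g has_derivative g') (at x)" "g x > (0::real)"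
  shows "((\<lambda>x. ln (g x)) has_derivative (\<lambda>h. g' h / g x)) (at x)"
  using has_derivative_ln[OF assms(2,1)] by (simp add: field_simps)

text \<open>At \<open>axis j 1\<close> and \<open>axis j \<i>\<close> the derivative is
  \<open>a j + b j\<close> and \<open>\<i> * (a j - b j)\<close>; the two Wirtinger combinations
  separate these.\<close>

lemma wirtinger_eqI:
  assumes "(F has_derivative (\<lambda>X. a 1 * X $ 1 + a 2 * X $ 2 + b 1 * cnj (X $ 1) + b 2 * cnj (X $ 2))) (at p)"
  shows "wirtinger j F p = a j" "wirtinger_bar j F p = b j"
proof -
  have e: "frechet_derivative F (at p) = (\<lambda>X. a 1 * X $ 1 + a 2 * X $ 2 + b 1 * cnj (X $ 1) + b 2 * cnj (X $ 2))"
    using frechet_derivative_at[OF assms] by simp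
  show "wirtinger j F p = a j" "wirtinger_bar j F p = b j"
    unfolding wirtinger_def wirtinger_bar_def e
    using exhaust_2[of j]
    by (elim disjE; simp add: axis_def algebra_simps)+
qed

lemma open_nonzero_fibre: "open {q :: complex ^ 2. q $ 2 \<noteq> 0}"
  by (intro open_Collect_neq continuous_intros)

text \<open>Expressed through \<open>eh_Q\<close> rather than through d log u, so that it also holds
  on the zero section, which curves may meet.\<close>

lemma has_derivative_usq:
  "(usq has_derivative (\<lambda>X. 4 * (1 + (cmod (p $ 1))\<^sup>2) * (p $ 2 \<bullet> eh_Q p X))) (at p)"
proof -
  have "((\<lambda>p. (p $ 2 \<bullet> p $ 2) * (1 + p $ 1 \<bullet> p $ 1)\<^sup>2) has_derivative
      (\<lambda>X. 4 * (1 + (cmod (p $ 1))\<^sup>2) * (p $ 2 \<bullet> eh_Q p X))) (at p)"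
    by (rule derivative_eq_intros refl ext)+ (simp add: eh_Q_def inner_complex_def cmod_power2, algebra)
  then show ?thesis
    by (simp add: usq_def[abs_def] power2_norm_eq_inner)
qed

section \<open>The potential and its complex Hessian\<close>

lemma norm_power2_complex: "(complex_of_real (cmod z))\<^sup>2 = z * cnj z"
  by (simp add: complex_norm_square flip: of_real_power)

lemma one_plus_cnj_ne_0: "1 + z * cnj z \<noteq> 0"
proof -
  have "1 + z * cnj z = of_real (1 + (cmod z)\<^sup>2)"
    by (simp add: norm_power2_complex)
  moreover have "1 + (cmod z)\<^sup>2 \<noteq> 0"
    by (smt (verit) zero_le_power2)
  ultimately show ?thesis
    by (metis of_real_eq_0_iff)
qed

lemma usq_complex: "complex_of_real (usq p) = p $ 2 * cnj (p $ 2) * (1 + p $ 1 * cnj (p $ 1))\<^sup>2"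
  by (simp add: usq_def norm_power2_complex)

lemma usq_nonneg: "usq p \<ge> 0"
  by (simp add: usq_def)

lemma usq_pos: "p $ 2 \<noteq> 0 \<Longrightarrow> usq p > 0"
  unfolding usq_def
  by (intro mult_pos_pos zero_less_power add_pos_nonneg) auto

text \<open>This is \<open>\<partial> log u(X)\<close>.\<close>

definition dlogu :: "complex ^ 2 \<Rightarrow> complex ^ 2 \<Rightarrow> complex" where
  "dlogu p X = X $ 2 / (2 * p $ 2) + cnj (p $ 1) * X $ 1 / (1 + p $ 1 * cnj (p $ 1))"

lemma inner_complex_eq: "complex_of_real (a \<bullet> b) = (a * cnj b + cnj a * b) / 2"
  by (simp add: complex_eq_iff inner_complex_def)

text \<open>Both sides are d(u^2) = 2 u^2 d log u; since log u is real, d log u is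
  \<open>dlogu\<close> plus its conjugate.\<close>

lemma usq_derivative_eq_dlogu:
  assumes "p $ 2 \<noteq> 0"
  shows "complex_of_real (4 * (1 + (cmod (p $ 1))\<^sup>2) * (p $ 2 \<bullet> eh_Q p X))
    = 2 * of_real (usq p) * (dlogu p X + cnj (dlogu p X))"
proof -
  have Q: "eh_Q p X = p $ 2 * (1 + p $ 1 * cnj (p $ 1)) * dlogu p X"
  proof -
    define D where "D = 1 + p $ 1 * cnj (p $ 1)"
    have "D \<noteq> 0"
      unfolding D_def by (rule one_plus_cnj_ne_0)
    then show ?thesis
      unfolding eh_Q_def dlogu_def D_def[symmetric] using assms by (simp add: field_simps)
  qed
  show ?thesis
    by (simp add: inner_complex_eq usq_complex Q norm_power2_complex) algebra
qed

context
  fixes t :: real assumes t: "t > 0"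
begin

lemma sqrt_usq_pos: "sqrt (usq p + t ^ 4) > 0"
  using t usq_nonneg[of p] by (simp add: add_nonneg_pos)

lemma has_derivative_sqrt_usq:
  assumes "p $ 2 \<noteq> 0"
  shows "((\<lambda>p. complex_of_real (sqrt (usq p + t ^ 4))) has_derivative
    (\<lambda>X. of_real (usq p / sqrt (usq p + t ^ 4)) * (dlogu p X + cnj (dlogu p X)))) (at p)"
proof -
  have "((\<lambda>p. sqrt (usq p + t ^ 4)) has_derivative
      (\<lambda>X. (4 * (1 + (cmod (p $ 1))\<^sup>2) * (p $ 2 \<bullet> eh_Q p X)) / (2 * sqrt (usq p + t ^ 4)))) (at p)"
    using sqrt_usq_pos[of p]
    by (auto intro!: derivative_eq_intros has_derivative_usq simp: field_simps)
  note has_derivative_of_real[OF this, where 'a = complex]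
  moreover have "complex_of_real ((4 * (1 + (cmod (p $ 1))\<^sup>2) * (p $ 2 \<bullet> eh_Q p X)) / (2 * sqrt (usq p + t ^ 4)))
      = of_real (usq p / sqrt (usq p + t ^ 4)) * (dlogu p X + cnj (dlogu p X))" for X
    unfolding of_real_divide usq_derivative_eq_dlogu[OF assms] by simp
  ultimately show ?thesis
    by simp
qed

lemma has_derivative_potential:
  assumes "p $ 2 \<noteq> 0"
  shows "((\<lambda>p. complex_of_real ((eh_potential t \<circ> eh_point k) p)) has_derivative
    (\<lambda>X. of_real (sqrt (usq p + t ^ 4)) * (dlogu p X + cnj (dlogu p X)))) (at p)"
proof -
  define d where "d = (\<lambda>X. 4 * (1 + (cmod (p $ 1))\<^sup>2) * (p $ 2 \<bullet> eh_Q p X))"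
  define S where "S = (\<lambda>p. sqrt (usq p + t ^ 4))"
  have S: "S p > 0" for p
    using sqrt_usq_pos by (simp add: S_def)
  have S2: "(S p)\<^sup>2 = usq p + t ^ 4"
    using t usq_nonneg[of p] by (simp add: S_def)
  have m: "usq p > 0"
    using assms by (rule usq_pos)
  have dm: "(usq has_derivative d) (at p)"
    unfolding d_def by (rule has_derivative_usq)
  have dS: "(S has_derivative (\<lambda>X. d X / (2 * S p))) (at p)"
    unfolding S_def using S[of p] unfolding S_def
    by (auto intro!: derivative_eq_intros dm simp: field_simps)
  have dS': "((\<lambda>p. S p + t\<^sup>2) has_derivative (\<lambda>X. d X / (2 * S p))) (at p)"
    by (rule derivative_eq_intros dS refl)+ simp
  have St: "S p + t\<^sup>2 > 0"
    using S[of p] by (simp add: add_pos_nonneg)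
  \<comment> \<open>The potential with log u replaced by half of log (u^2).\<close>
  have "((\<lambda>p. S p + t\<^sup>2 * (ln (usq p) / 2 - ln (S p + t\<^sup>2))) has_derivative
     (\<lambda>X. d X / (2 * S p) + t\<^sup>2 * (d X / usq p / 2 - d X / (2 * S p) / (S p + t\<^sup>2)))) (at p)"
    unfolding divide_inverse[of _ 2]
    by (intro has_derivative_add dS has_derivative_mult_right has_derivative_diff
        has_derivative_mult_left has_derivative_ln_gen[OF dm m] has_derivative_ln_gen[OF dS' St])
  also have "(\<lambda>X. d X / (2 * S p) + t\<^sup>2 * (d X / usq p / 2 - d X / (2 * S p) / (S p + t\<^sup>2)))
     = (\<lambda>X. S p * (d X / (2 * usq p)))"
  proof
    fix X
    \<comment> \<open>The logarithmic terms collapse because u^2 = S^2 - t^4 = (S - t^2)(S + t^2).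
      This turns the claim into the rational identity \<open>*\<close> with s = S and b =
      t^2.\<close>
    have "1 / (2 * S p) + t\<^sup>2 * (1 / usq p / 2 - 1 / (2 * S p) / (S p + t\<^sup>2)) = S p / (2 * usq p)"
    proof -
      have *: "1 / (2 * s) + b * (1 / ((s - b) * (s + b)) / 2 - 1 / (2 * s) / (s + b)) = s / (2 * ((s - b) * (s + b)))"
        if "s \<noteq> 0" "s + b \<noteq> 0" "s - b \<noteq> 0" for s b :: real
        using that by (simp add: divide_simps) algebra
      have m': "usq p = (S p - t\<^sup>2) * (S p + t\<^sup>2)"
        using S2 by (simp add: algebra_simps power2_eq_square power4_eq_xxxx)
      with m have "S p - t\<^sup>2 \<noteq> 0" by auto
      then show ?thesis
        unfolding m' using S[of p] St by (intro *) auto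
    qed
    from arg_cong[OF this, of "\<lambda>x. d X * x"]
    show "d X / (2 * S p) + t\<^sup>2 * (d X / usq p / 2 - d X / (2 * S p) / (S p + t\<^sup>2)) = S p * (d X / (2 * usq p))"
      by (simp add: algebra_simps)
  qed
  finally have "((\<lambda>p. S p + t\<^sup>2 * (ln (usq p) / 2 - ln (S p + t\<^sup>2))) has_derivative
     (\<lambda>X. S p * (d X / (2 * usq p)))) (at p)" .
  note has_derivative_of_real[OF this, where 'a = complex]
  also have "(\<lambda>X. complex_of_real (S p * (d X / (2 * usq p)))) =
     (\<lambda>X. of_real (S p) * (dlogu p X + cnj (dlogu p X)))"
    using m unfolding of_real_divide of_real_mult d_def fun_eq_iff
    by (simp only: usq_derivative_eq_dlogu[OF assms] flip: of_real_mult) simp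
  finally have *: "((\<lambda>p. complex_of_real (S p + t\<^sup>2 * (ln (usq p) / 2 - ln (S p + t\<^sup>2)))) has_derivative
     (\<lambda>X. of_real (S p) * (dlogu p X + cnj (dlogu p X)))) (at p)" .
  have "((\<lambda>p. complex_of_real ((eh_potential t \<circ> eh_point k) p)) has_derivative
     (\<lambda>X. of_real (S p) * (dlogu p X + cnj (dlogu p X)))) (at p)"
  proof (rule has_derivative_transform_within_open[OF * open_nonzero_fibre])
    show "p \<in> {q. q $ 2 \<noteq> 0}" using assms by simp
    fix q :: "complex ^ 2" assume "q \<in> {q. q $ 2 \<noteq> 0}"
    then have mq: "usq q > 0" by (simp add: usq_pos)
    have u: "eh_u (eh_point k q) = sqrt (usq q)"
      by (simp add: eh_u_point usq_def real_sqrt_mult)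
    have "0 < S q + t\<^sup>2" using S[of q] by (simp add: add_pos_nonneg)
    then have "ln (sqrt (usq q) / (S q + t\<^sup>2)) = ln (usq q) / 2 - ln (S q + t\<^sup>2)"
      using mq by (simp add: ln_div ln_sqrt)
    then show "complex_of_real (S q + t\<^sup>2 * (ln (usq q) / 2 - ln (S q + t\<^sup>2))) =
      complex_of_real ((eh_potential t \<circ> eh_point k) q)"
      using mq by (simp add: eh_potential_def u S_def)
  qed
  then show ?thesis
    by (simp add: S_def)
qed

text \<open>S times the antiholomorphic partial derivatives of log u: the first derivatives of the
  potential as a closed formula that can be differentiated again.\<close>

definition dbar :: "2 \<Rightarrow> complex ^ 2 \<Rightarrow> complex" where
  "dbar l p = of_real (sqrt (usq p + t ^ 4)) *
     (if l = 1 then p $ 1 / (1 + p $ 1 * cnj (p $ 1)) else 1 / (2 * cnj (p $ 2)))"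

lemma wirtinger_bar_potential:
  assumes "p $ 2 \<noteq> 0"
  shows "wirtinger_bar l (\<lambda>p. complex_of_real ((eh_potential t \<circ> eh_point k) p)) p = dbar l p"
proof -
  have "((\<lambda>p. complex_of_real ((eh_potential t \<circ> eh_point k) p)) has_derivative
    (\<lambda>X. (\<lambda>l. cnj (dbar l p)) 1 * X $ 1 + (\<lambda>l. cnj (dbar l p)) 2 * X $ 2
       + (\<lambda>l. dbar l p) 1 * cnj (X $ 1) + (\<lambda>l. dbar l p) 2 * cnj (X $ 2))) (at p)"
    by (rule has_derivative_eq_rhs[OF has_derivative_potential[OF assms, of k]])
       (auto simp: dbar_def dlogu_def algebra_simps)
  from wirtinger_eqI(2)[OF this] show ?thesis .
qed

text \<open>Product rule for \<open>dbar\<close>. The first summand comes from dS = (u^2/S) d log u,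
  the second from the Hessian of log (1 + |z|^2), hence only for j = l = 1. The factor 1 / (2 cnj w)
  is antiholomorphic and adds nothing.\<close>

lemma wirtinger_potential:
  assumes "p $ 2 \<noteq> 0"
  shows "wirtinger j (wirtinger_bar l (\<lambda>p. complex_of_real ((eh_potential t \<circ> eh_point k) p))) p =
    (let S = of_real (sqrt (usq p + t ^ 4)); z = p $ 1; w = p $ 2; D = 1 + z * cnj z;
         a = (\<lambda>j :: 2. if j = 1 then cnj z * inverse D else inverse (2 * w))
     in of_real (usq p) / S * a j * cnj (a l) + (if j = 1 \<and> l = 1 then S * inverse D * inverse D else 0))"
proof -
  define S z w D where "S = complex_of_real (sqrt (usq p + t ^ 4))" and "z = p $ 1" and "w = p $ 2"
    and "D = 1 + z * cnj z"
  define E v M where "E = inverse D" and "v = inverse (2 * w)" and "M = of_real (usq p) / S"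
  define a where "a = (\<lambda>j :: 2. if j = 1 then cnj z * E else v)"
  have D: "D \<noteq> 0" unfolding D_def by (rule one_plus_cnj_ne_0)
  have w: "w \<noteq> 0" using assms by (simp add: w_def)
  have cE: "cnj E = E" by (simp add: E_def D_def)
  have cv: "inverse (2 * cnj w) = cnj v" by (simp add: v_def)
  \<comment> \<open>The relation that reduces the quotient rule E - z cnj z E^2 to E^2.\<close>
  have E: "E * E * (1 + z * cnj z) = E"
    using D by (simp add: D_def[symmetric] E_def)
  have L: "dlogu p X = X $ 2 * v + cnj z * X $ 1 * E" for X
    by (simp add: dlogu_def E_def v_def D_def z_def w_def divide_inverse del: inverse_mult_distrib)
  define dS where "dS = (\<lambda>X. M * (dlogu p X + cnj (dlogu p X)))"
  have dS: "((\<lambda>p. complex_of_real (sqrt (usq p + t ^ 4))) has_derivative dS) (at p)"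
    using has_derivative_sqrt_usq[OF assms] by (simp add: dS_def S_def M_def)
  \<comment> \<open>\<open>h\<close> and \<open>b\<close> are the complex linear and antilinear
    coefficients of the derivative of \<open>dbar l\<close>; \<open>wirtinger_eqI\<close> takes the
    full real derivative as input.\<close>
  define b where "b = (\<lambda>j :: 2. M * cnj (a j) * cnj (a l)
      + (if l = 1 \<and> j = 1 then - S * z * z * E * E else if l = 2 \<and> j = 2 then - S * 2 * cnj v * cnj v else 0))"
  define h where "h = (\<lambda>j. M * a j * cnj (a l) + (if j = 1 \<and> l = 1 then S * E * E else 0))"
  have *: "(dbar l has_derivative (\<lambda>X. h 1 * X $ 1 + h 2 * X $ 2 + b 1 * cnj (X $ 1) + b 2 * cnj (X $ 2))) (at p)"
  proof (cases "l = 1")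
    case True
    have dD: "((\<lambda>p. 1 + p $ 1 * cnj (p $ 1)) has_derivative (\<lambda>X. z * cnj (X $ 1) + X $ 1 * cnj z)) (at p)"
      unfolding z_def by (auto intro!: derivative_eq_intros)
    have "((\<lambda>p. complex_of_real (sqrt (usq p + t ^ 4)) * (p $ 1 * inverse (1 + p $ 1 * cnj (p $ 1)))) has_derivative
      (\<lambda>X. S * (z * (- (E * (z * cnj (X $ 1) + X $ 1 * cnj z) * E)) + X $ 1 * E) + dS X * (z * E))) (at p)"
      using has_derivative_mult[OF dS has_derivative_mult[OF has_derivative_nth[OF has_derivative_ident, of 1]
          Deriv.has_derivative_inverse[OF one_plus_cnj_ne_0 dD]]]
      unfolding S_def[symmetric] z_def[symmetric] D_def[symmetric] E_def[symmetric] .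
    then have "(dbar l has_derivative
      (\<lambda>X. S * (z * (- (E * (z * cnj (X $ 1) + X $ 1 * cnj z) * E)) + X $ 1 * E) + dS X * (z * E))) (at p)"
      by (simp add: dbar_def[abs_def] True divide_inverse)
    moreover have "S * (z * (- (E * (z * cnj (X $ 1) + X $ 1 * cnj z) * E)) + X $ 1 * E) + dS X * (z * E)
       = h 1 * X $ 1 + h 2 * X $ 2 + b 1 * cnj (X $ 1) + b 2 * cnj (X $ 2)" for X
      unfolding dS_def L h_def b_def a_def True using E
      by (simp add: cE) algebra
    ultimately show ?thesis by simp
  next
    case False
    then have l: "l = 2" using exhaust_2 by blast
    have dw: "((\<lambda>p. 2 * cnj (p $ 2)) has_derivative (\<lambda>X. 2 * cnj (X $ 2))) (at p)"
      by (auto intro!: derivative_eq_intros)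
    have "2 * cnj (p $ 2) \<noteq> 0"
      using assms by simp
    from has_derivative_mult[OF dS Deriv.has_derivative_inverse[OF this dw]]
    have "((\<lambda>p. complex_of_real (sqrt (usq p + t ^ 4)) * inverse (2 * cnj (p $ 2))) has_derivative
      (\<lambda>X. S * (- (cnj v * (2 * cnj (X $ 2)) * cnj v)) + dS X * cnj v)) (at p)"
      unfolding S_def[symmetric] w_def[symmetric] cv .
    then have "(dbar l has_derivative
      (\<lambda>X. S * (- (cnj v * (2 * cnj (X $ 2)) * cnj v)) + dS X * cnj v)) (at p)"
      by (simp add: dbar_def[abs_def] l inverse_eq_divide del: inverse_mult_distrib)
    moreover have "S * (- (cnj v * (2 * cnj (X $ 2)) * cnj v)) + dS X * cnj v
       = h 1 * X $ 1 + h 2 * X $ 2 + b 1 * cnj (X $ 1) + b 2 * cnj (X $ 2)" for X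
      unfolding dS_def L h_def b_def a_def l
      by (simp add: cE) algebra
    ultimately show ?thesis by simp
  qed
  have "(wirtinger_bar l (\<lambda>p. complex_of_real ((eh_potential t \<circ> eh_point k) p)) has_derivative
      (\<lambda>X. h 1 * X $ 1 + h 2 * X $ 2 + b 1 * cnj (X $ 1) + b 2 * cnj (X $ 2))) (at p)"
    by (rule has_derivative_transform_within_open[OF * open_nonzero_fibre])
       (use assms wirtinger_bar_potential in auto)
  from wirtinger_eqI(1)[OF this, of j] show ?thesis
    unfolding Let_def h_def a_def M_def E_def v_def D_def S_def z_def w_def .
qed

text \<open>Taking real parts leaves -2 Im T(X, Y), and -Im (a cnj b) is the inner product of a with
  -\<i> b. The argument -\<i> Y cancels later against the complex structure in
  \<open>eh_metric\<close>.\<close>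

lemma i_ddbar_potential:
  assumes "p $ 2 \<noteq> 0"
  shows "i_ddbar (eh_potential t \<circ> eh_point k) p X Y = eh_form t p X (- \<i> *s Y)"
proof -
  define S z w D where "S = complex_of_real (sqrt (usq p + t ^ 4))" and "z = p $ 1" and "w = p $ 2"
    and "D = 1 + z * cnj z"
  define E v M where "E = inverse D" and "v = inverse (2 * w)" and "M = of_real (usq p) / S"
  define a where "a = (\<lambda>j :: 2. if j = 1 then cnj z * E else v)"
  define h where "h = (\<lambda>j l. M * a j * cnj (a l) + (if j = 1 \<and> l = 1 then S * E * E else 0))"
  have D: "D \<noteq> 0" unfolding D_def by (rule one_plus_cnj_ne_0)
  have w: "w \<noteq> 0" using assms by (simp add: w_def)
  have cD: "cnj D = D" and cE: "cnj E = E" by (simp_all add: E_def D_def)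
  have M: "M = w * cnj w * D * D * inverse S"
    by (simp add: M_def usq_complex w_def D_def z_def power2_eq_square divide_inverse)
  have H: "wirtinger j (wirtinger_bar l (\<lambda>q. complex_of_real ((eh_potential t \<circ> eh_point k) q))) p = h j l" for j l
    unfolding wirtinger_potential[OF assms] Let_def h_def a_def M_def E_def v_def D_def S_def z_def w_def ..
  \<comment> \<open>The Hermitian form S P cnj P + Q cnj Q / S; the factor u^2 in \<open>M\<close>
    is absorbed by the factor w (1 + |z|^2) of Q and its conjugate.\<close>
  define T where "T = (\<lambda>X Y. S * eh_P p X * cnj (eh_P p Y) + inverse S * eh_Q p X * cnj (eh_Q p Y))"
  have T: "(\<Sum>j\<in>UNIV. \<Sum>l\<in>UNIV. h j l * (X $ j * cnj (Y $ l))) = T X Y" for X Y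
  proof -
    have Q: "eh_Q p X = w * D * (a 1 * X $ 1 + a 2 * X $ 2)" for X
      using D w unfolding eh_Q_def w_def[symmetric] z_def[symmetric] D_def[symmetric]
      by (simp add: a_def E_def v_def field_simps)
    have P: "eh_P p X = X $ 1 * E" for X
      by (simp add: eh_P_def D_def z_def E_def divide_inverse)
    have one: "(1 :: 2) \<noteq> 2" by simp
    show ?thesis
      unfolding T_def sum_2 h_def Q P M complex_cnj_mult complex_cnj_add cD cE
      by (simp only: simp_thms if_True if_False one one[symmetric]) algebra
  qed
  have T_sym: "T Y X = cnj (T X Y)" for X Y
    by (simp add: T_def S_def)
  have "i_ddbar (eh_potential t \<circ> eh_point k) p X Y =
     Re (\<i> * ((\<Sum>j\<in>UNIV. \<Sum>l\<in>UNIV. h j l * (X $ j * cnj (Y $ l))) - (\<Sum>j\<in>UNIV. \<Sum>l\<in>UNIV. h j l * (Y $ j * cnj (X $ l)))))"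
    unfolding i_ddbar_def H by (simp add: right_diff_distrib sum_subtractf)
  also have "\<dots> = Re (\<i> * (T X Y - cnj (T X Y)))"
    unfolding T T_sym[of Y X] ..
  also have "\<dots> = - 2 * Im (T X Y)"
    by simp
  also have "\<dots> = eh_form t p X (- \<i> *s Y)"
  proof -
    have P: "eh_P p (- \<i> *s Y) = - \<i> * eh_P p Y" and Q: "eh_Q p (- \<i> *s Y) = - \<i> * eh_Q p Y"
      by (simp_all add: eh_P_def eh_Q_def algebra_simps)
    have T': "T X Y = of_real (sqrt (usq p + t ^ 4)) * (eh_P p X * cnj (eh_P p Y))
        + of_real (inverse (sqrt (usq p + t ^ 4))) * (eh_Q p X * cnj (eh_Q p Y))"
      by (simp add: T_def S_def)
    have inner: "a \<bullet> (- \<i> * b) = - Im (a * cnj b)" for a b :: complex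
      by (simp add: inner_complex_def)
    have Im: "Im (of_real s * A + of_real r * B) = s * Im A + r * Im B" for s r A B
      by simp
    show ?thesis
      unfolding eh_form_def P Q inner T' Im divide_inverse by algebra
  qed
  finally show ?thesis .
qed

end

section \<open>The metric\<close>

text \<open>Makes the filter in \<open>eh_omega\<close> nontrivial, so that \<open>Lim\<close> there
  has a unique value.\<close>

lemma islimpt_nonzero_fibre: "p islimpt {q :: complex ^ 2. q $ 2 \<noteq> 0}"
  unfolding islimpt_approachable
proof (intro allI impI)
  fix e :: real assume e: "e > 0"
  \<comment> \<open>Shift the fibre coordinate by e/2, or by e/4 if the first shift would land on
    0.\<close>
  define c where "c = (if p $ 2 = complex_of_real (- e / 2) then e / 4 else e / 2)"
  define q where "q = p + axis 2 (complex_of_real c)"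
  have c: "0 < c" "c < e"
    using e by (auto simp: c_def)
  have "q $ 2 \<noteq> 0"
  proof
    assume "q $ 2 = 0"
    then have "p $ 2 = complex_of_real (- c)"
      by (simp add: q_def axis_def eq_neg_iff_add_eq_0)
    with e show False
      by (auto simp: c_def split: if_splits simp del: of_real_minus of_real_divide)
  qed
  moreover have "dist q p = c"
    using c by (simp add: q_def dist_norm norm_vec_def L2_set_def sum_2 axis_def)
  ultimately show "\<exists>x'\<in>{q. q $ 2 \<noteq> 0}. x' \<noteq> p \<and> dist x' p < e"
    using c by (intro bexI[of _ q]) auto
qed

lemma eh_form_continuous:
  assumes t: "t > 0"
  shows "isCont (\<lambda>p. eh_form t p X Y) p"
proof -
  have "sqrt (usq p + t ^ 4) \<noteq> 0"
    using sqrt_usq_pos[OF t, of p] by simp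
  moreover have "1 + p $ 1 * cnj (p $ 1) \<noteq> 0"
    by (rule one_plus_cnj_ne_0)
  ultimately show ?thesis
    unfolding eh_form_def eh_P_def eh_Q_def
    unfolding usq_def
    by (intro continuous_intros) (simp_all)
qed

text \<open>Off the zero section this is the Hessian computation; on it, the continuity of
  \<open>eh_form\<close> identifies the limit.\<close>

lemma eh_metric_eq_form:
  assumes t: "t > 0"
  shows "eh_metric t k p X Y = eh_form t p X Y"
proof -
  have omega: "eh_omega t k p X Z = eh_form t p X (- \<i> *s Z)" for Z
  proof (cases "p $ 2 = 0")
    case False
    then show ?thesis
      by (simp add: eh_omega_def i_ddbar_potential[OF t])
  next
    case True
    have "((\<lambda>q. eh_form t q X (- \<i> *s Z)) \<longlongrightarrow> eh_form t p X (- \<i> *s Z)) (at p within {q. q $ 2 \<noteq> 0})"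
      using eh_form_continuous[OF t] by (meson isContD tendsto_within_subset subset_UNIV)
    then have "((\<lambda>q. i_ddbar (eh_potential t \<circ> eh_point k) q X Z) \<longlongrightarrow> eh_form t p X (- \<i> *s Z))
        (at p within {q. q $ 2 \<noteq> 0})"
      by (rule Lim_transform_within[OF _ zero_less_one]) (simp add: i_ddbar_potential[OF t])
    moreover have "at p within {q. q $ 2 \<noteq> 0} \<noteq> bot"
      using islimpt_nonzero_fibre trivial_limit_within by blast
    ultimately show ?thesis
      using True by (simp add: eh_omega_def tendsto_Lim)
  qed
  have "- \<i> *s (\<i> *s Y) = Y"
    by (simp add: vec_eq_iff)
  then show ?thesis
    unfolding eh_metric_def omega by simp
qed

section \<open>Maps given by homogeneous coordinates\<close>

lemma linear_vector2: "linear (\<lambda>c. vector [c, 0] :: complex ^ 2)" "linear (\<lambda>c. vector [0, c] :: complex ^ 2)"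
  by (auto intro!: linearI simp: vec_eq_iff forall_2)

lemma vector2_split: "(vector [a, b] :: complex ^ 2) = vector [a, 0] + vector [0, b]"
  by (auto simp: vec_eq_iff forall_2)

lemma has_derivative_vector2:
  assumes "(f has_derivative f') F" "(g has_derivative g') F"
  shows "((\<lambda>x. vector [f x, g x] :: complex ^ 2) has_derivative (\<lambda>h. vector [f' h, g' h])) F"
  using has_derivative_add[OF bounded_linear.has_derivative[OF linear_vector2(1)[THEN linear_conv_bounded_linear[THEN iffD1]] assms(1)]
      bounded_linear.has_derivative[OF linear_vector2(2)[THEN linear_conv_bounded_linear[THEN iffD1]] assms(2)]]
  by (simp flip: vector2_split)

lemma continuous_on_vector2:
  assumes "continuous_on A f" "continuous_on A g"
  shows "continuous_on A (\<lambda>x. vector [f x, g x] :: complex ^ 2)"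
  using continuous_on_add[OF bounded_linear.continuous_on[OF linear_vector2(1)[THEN linear_conv_bounded_linear[THEN iffD1]] assms(1)]
      bounded_linear.continuous_on[OF linear_vector2(2)[THEN linear_conv_bounded_linear[THEN iffD1]] assms(2)]]
  by (simp flip: vector2_split)

text \<open>On a Euclidean source, continuity in operator norm follows from continuity of the
  derivative in each direction.\<close>

lemma C1_onI:
  fixes f :: "'a::euclidean_space \<Rightarrow> 'b::real_normed_vector"
  assumes "open W" "\<And>x. x \<in> W \<Longrightarrow> (f has_derivative f' x) (at x)" "\<And>h. continuous_on W (\<lambda>x. f' x h)"
  shows "C1_on f W"
proof -
  have b: "blinfun_apply (Blinfun (f' x)) = f' x" if "x \<in> W" for x
    using assms(2)[OF that] by (intro bounded_linear_Blinfun_apply has_derivative_bounded_linear)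
  have "continuous_on W (\<lambda>x. Blinfun (f' x))"
  proof (rule continuous_on_blinfun_componentwise)
    fix i :: 'a
    have "continuous_on W (\<lambda>x. blinfun_apply (Blinfun (f' x)) i) \<longleftrightarrow> continuous_on W (\<lambda>x. f' x i)"
      by (rule continuous_on_cong) (simp_all add: b)
    with assms(3) show "continuous_on W (\<lambda>x. blinfun_apply (Blinfun (f' x)) i)"
      by simp
  qed
  with assms b show ?thesis
    unfolding C1_on_def by (intro conjI exI[of _ "\<lambda>x. Blinfun (f' x)"]) auto
qed

lemma C1_on_differentiable: "C1_on f W \<Longrightarrow> x \<in> W \<Longrightarrow> f differentiable (at x)"
  by (auto simp: C1_on_def differentiable_def)

text \<open>Up to a phase, these are the values of \<open>eh_P\<close> and \<open>eh_Q\<close> in homogeneous coordinates.\<close>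

definition hom_P :: "complex \<Rightarrow> complex \<Rightarrow> complex \<Rightarrow> complex \<Rightarrow> complex" where
  "hom_P \<alpha> \<beta> \<alpha>' \<beta>' = (\<alpha>' * \<beta> - \<alpha> * \<beta>') / (\<alpha> * cnj \<alpha> + \<beta> * cnj \<beta>)"

definition hom_Q :: "complex \<Rightarrow> complex \<Rightarrow> complex \<Rightarrow> complex \<Rightarrow> complex \<Rightarrow> complex \<Rightarrow> complex" where
  "hom_Q \<alpha> \<beta> \<gamma> \<alpha>' \<beta>' \<gamma>' = (\<alpha> * cnj \<alpha> + \<beta> * cnj \<beta>) * \<gamma>' / 2 + \<gamma> * (cnj \<alpha> * \<alpha>' + cnj \<beta> * \<beta>')"

lemma inner_phase: "cmod e = 1 \<Longrightarrow> (e * a) \<bullet> (e * b) = a \<bullet> b" for a b :: complex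
proof -
  assume "cmod e = 1"
  then have "e * cnj e = 1"
    by (simp add: complex_norm_square[symmetric])
  have "complex_of_real ((e * a) \<bullet> (e * b)) = (e * cnj e) * complex_of_real (a \<bullet> b)"
    by (simp add: inner_complex_eq) algebra
  with \<open>e * cnj e = 1\<close> show ?thesis
    by simp
qed

lemma norm_sq_sum_ne_0: "a \<noteq> 0 \<or> b \<noteq> 0 \<Longrightarrow> a * cnj a + b * cnj b \<noteq> 0"
proof -
  assume "a \<noteq> 0 \<or> b \<noteq> 0"
  then have "(cmod a)\<^sup>2 + (cmod b)\<^sup>2 \<noteq> 0"
    by (simp add: sum_power2_eq_zero_iff)
  moreover have "a * cnj a + b * cnj b = of_real ((cmod a)\<^sup>2 + (cmod b)\<^sup>2)"
    by (simp add: norm_power2_complex)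
  ultimately show ?thesis
    by (metis of_real_eq_0_iff)
qed

text \<open>The second vector is the derivative of (a/b, c b^2) when a, b, c move with velocities
  a', b', c'. The choice of chart survives only in the unit factors cnj b / b and b / cnj b, which
  inner products do not see.\<close>

lemma eh_PQ_homogeneous:
  assumes b: "b \<noteq> 0"
  shows "eh_P (vector [a / b, c * b\<^sup>2]) (vector [(a' * b - a * b') / b\<^sup>2, c' * b\<^sup>2 + 2 * c * b * b'])
      = cnj b / b * hom_P a b a' b'"
    and "eh_Q (vector [a / b, c * b\<^sup>2]) (vector [(a' * b - a * b') / b\<^sup>2, c' * b\<^sup>2 + 2 * c * b * b'])
      = b / cnj b * hom_Q a b c a' b' c'"
proof -
  have N: "a * cnj a + b * cnj b \<noteq> 0"
    using b by (intro norm_sq_sum_ne_0) simp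
  have e: "1 + a / b * cnj (a / b) = (a * cnj a + b * cnj b) / (b * cnj b)"
    using b by (simp add: field_simps)
  define N where "N = a * cnj a + b * cnj b"
  define z where "z = a * b' - a' * b"
  show "eh_P (vector [a / b, c * b\<^sup>2]) (vector [(a' * b - a * b') / b\<^sup>2, c' * b\<^sup>2 + 2 * c * b * b'])
      = cnj b / b * hom_P a b a' b'"
    using b N unfolding eh_P_def hom_P_def vector_2 e N_def[symmetric]
    by (simp add: power2_eq_square)
  have sum: "N / (b * cnj b) * (2 * c * b * b') / 2 + c * b\<^sup>2 * cnj (a / b) * ((a' * b - a * b') / b\<^sup>2)
     = b / cnj b * (c * (cnj a * a' + cnj b * b'))"
    using b by (simp add: N_def power2_eq_square field_simps)
  show "eh_Q (vector [a / b, c * b\<^sup>2]) (vector [(a' * b - a * b') / b\<^sup>2, c' * b\<^sup>2 + 2 * c * b * b'])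
      = b / cnj b * hom_Q a b c a' b' c'"
  proof -
    have "N / (b * cnj b) * (c' * b\<^sup>2 + 2 * c * b * b') / 2
        = b / cnj b * (N * c' / 2) + N / (b * cnj b) * (2 * c * b * b') / 2"
      using b by (simp add: power2_eq_square field_simps)
    then show ?thesis
      using sum unfolding eh_Q_def hom_Q_def vector_2 e N_def[symmetric]
      by (simp only: distrib_left add.assoc)
  qed
qed

lemma eh_P_zero [simp]: "eh_P p 0 = 0" and eh_Q_zero [simp]: "eh_Q p 0 = 0"
  by (simp_all add: eh_P_def eh_Q_def)

lemma eh_index_at_abs:
  assumes "\<alpha> \<noteq> 0 \<or> \<beta> \<noteq> 0"
  shows "eh_index_at (abs_h2 (\<alpha>, \<beta>, \<gamma>)) = Aff \<Longrightarrow> \<beta> \<noteq> 0"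
    and "eh_index_at (abs_h2 (\<alpha>, \<beta>, \<gamma>)) = AtInf \<Longrightarrow> \<alpha> \<noteq> 0"
  using assms eh_index_at_dom[of "abs_h2 (\<alpha>, \<beta>, \<gamma>)"] by (auto simp: eh_dom_abs simp del: eh_dom.simps)

lemma has_derivative_homogeneous:
  fixes a b c :: "'a::real_normed_vector \<Rightarrow> complex"
  assumes "(a has_derivative a') (at x)" "(b has_derivative b') (at x)" "(c has_derivative c') (at x)" "b x \<noteq> 0"
  shows "((\<lambda>x. vector [a x / b x, c x * (b x)\<^sup>2] :: complex ^ 2) has_derivative
    (\<lambda>h. vector [(a' h * b x - a x * b' h) / (b x)\<^sup>2, c' h * (b x)\<^sup>2 + 2 * c x * b x * b' h])) (at x)"
proof (rule has_derivative_vector2)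
  show "((\<lambda>x. a x / b x) has_derivative (\<lambda>h. (a' h * b x - a x * b' h) / (b x)\<^sup>2)) (at x)"
    using has_derivative_divide'[OF assms(1,2,4)] by (simp add: power2_eq_square)
  have "((\<lambda>x. c x * (b x * b x)) has_derivative (\<lambda>h. c x * (b x * b' h + b' h * b x) + c' h * (b x * b x))) (at x)"
    by (intro has_derivative_mult assms)
  moreover have "(\<lambda>h. c x * (b x * b' h + b' h * b x) + c' h * (b x * b x)) = (\<lambda>h. c' h * (b x)\<^sup>2 + 2 * c x * b x * b' h)"
    by (simp add: power2_eq_square algebra_simps)
  ultimately show "((\<lambda>x. c x * (b x)\<^sup>2) has_derivative (\<lambda>h. c' h * (b x)\<^sup>2 + 2 * c x * b x * b' h)) (at x)"
    by (simp add: power2_eq_square)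
qed

lemma has_derivative_chart_abs:
  assumes d: "(a has_derivative a') (at x)" "(b has_derivative b') (at x)" "(c has_derivative c') (at x)"
  shows "b x \<noteq> 0 \<Longrightarrow> (eh_chart Aff \<circ> (\<lambda>x. abs_h2 (a x, b x, c x)) has_derivative
      (\<lambda>h. vector [(a' h * b x - a x * b' h) / (b x)\<^sup>2, c' h * (b x)\<^sup>2 + 2 * c x * b x * b' h])) (at x)"
    and "a x \<noteq> 0 \<Longrightarrow> (eh_chart AtInf \<circ> (\<lambda>x. abs_h2 (a x, b x, c x)) has_derivative
      (\<lambda>h. vector [(b' h * a x - b x * a' h) / (a x)\<^sup>2, c' h * (a x)\<^sup>2 + 2 * c x * a x * a' h])) (at x)"
proof -
  have c: "\<forall>\<^sub>F y in at x. f y \<noteq> 0" if "(f has_derivative f') (at x)" "f x \<noteq> 0" for f f' :: "'a \<Rightarrow> complex"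
    using that has_derivative_continuous isContD tendsto_imp_eventually_ne by blast
  { assume "b x \<noteq> 0"
    then show "(eh_chart Aff \<circ> (\<lambda>x. abs_h2 (a x, b x, c x)) has_derivative
      (\<lambda>h. vector [(a' h * b x - a x * b' h) / (b x)\<^sup>2, c' h * (b x)\<^sup>2 + 2 * c x * b x * b' h])) (at x)"
      by (intro has_derivative_transform_eventually[OF has_derivative_homogeneous[OF d]] eventually_mono[OF c[OF d(2)]])
         (auto simp: eh_chart_abs) }
  { assume "a x \<noteq> 0"
    then show "(eh_chart AtInf \<circ> (\<lambda>x. abs_h2 (a x, b x, c x)) has_derivative
      (\<lambda>h. vector [(b' h * a x - b x * a' h) / (a x)\<^sup>2, c' h * (a x)\<^sup>2 + 2 * c x * a x * a' h])) (at x)"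
      by (intro has_derivative_transform_eventually[OF has_derivative_homogeneous[OF d(2,1,3)]] eventually_mono[OF c[OF d(1)]])
         (auto simp: eh_chart_abs) }
qed

text \<open>The right-hand side does not mention the chart chosen by \<open>eh_index_at\<close>;
  both charts yield the same expression.\<close>

lemma eh_pullback_abs:
  assumes t: "t > 0" and d: "(a has_derivative a') (at x)" "(b has_derivative b') (at x)" "(c has_derivative c') (at x)"
    and nz: "a x \<noteq> 0 \<or> b x \<noteq> 0"
  shows "eh_pullback t (\<lambda>x. abs_h2 (a x, b x, c x)) x v w =
    2 * eh_S t (abs_h2 (a x, b x, c x)) * (hom_P (a x) (b x) (a' v) (b' v) \<bullet> hom_P (a x) (b x) (a' w) (b' w))
    + 2 / eh_S t (abs_h2 (a x, b x, c x)) *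
       (hom_Q (a x) (b x) (c x) (a' v) (b' v) (c' v) \<bullet> hom_Q (a x) (b x) (c x) (a' w) (b' w) (c' w))"
proof (cases "eh_index_at (abs_h2 (a x, b x, c x))")
  case Aff
  then have b: "b x \<noteq> 0"
    using eh_index_at_abs[OF nz] by blast
  have S: "eh_S t (abs_h2 (a x, b x, c x)) = sqrt (usq (eh_chart Aff (abs_h2 (a x, b x, c x))) + t ^ 4)"
    unfolding eh_S_def using eh_u_chart[of "abs_h2 (a x, b x, c x)" Aff] b nz by (simp add: eh_proj_abs)
  note D = frechet_derivative_at[OF has_derivative_chart_abs(1)[OF d b], symmetric]
  have ph: "cmod (cnj (b x) / b x) = 1" "cmod (b x / cnj (b x)) = 1"
    using b by (simp_all add: norm_divide)
  show ?thesis
    unfolding eh_pullback_def Aff eh_metric_eq_form[OF t] eh_form_def eh_deriv_def D S[symmetric]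
    unfolding eh_chart_abs(1)[OF nz] eh_PQ_homogeneous[OF b] ph[THEN inner_phase] ..
next
  case AtInf
  then have b: "a x \<noteq> 0"
    using eh_index_at_abs[OF nz] by blast
  have S: "eh_S t (abs_h2 (a x, b x, c x)) = sqrt (usq (eh_chart AtInf (abs_h2 (a x, b x, c x))) + t ^ 4)"
    unfolding eh_S_def using eh_u_chart[of "abs_h2 (a x, b x, c x)" AtInf] b nz by (simp add: eh_proj_abs)
  note D = frechet_derivative_at[OF has_derivative_chart_abs(2)[OF d b], symmetric]
  have ph: "cmod (cnj (a x) / a x) = 1" "cmod (a x / cnj (a x)) = 1"
    using b by (simp_all add: norm_divide)
  \<comment> \<open>The other chart exchanges the two homogeneous coordinates: \<open>hom_P\<close>
    is antisymmetric and \<open>hom_Q\<close> symmetric, and the sign cancels in the inner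
    product.\<close>
  have P: "hom_P (b x) (a x) (b' v) (a' v) = - hom_P (a x) (b x) (a' v) (b' v)" for v
    by (simp add: hom_P_def algebra_simps minus_divide_left)
  have Q: "hom_Q (b x) (a x) (c x) (b' v) (a' v) (c' v) = hom_Q (a x) (b x) (c x) (a' v) (b' v) (c' v)" for v
    by (simp add: hom_Q_def algebra_simps)
  show ?thesis
    unfolding eh_pullback_def AtInf eh_metric_eq_form[OF t] eh_form_def eh_deriv_def D S[symmetric]
    unfolding eh_chart_abs(2)[OF nz] eh_PQ_homogeneous[OF b] ph[THEN inner_phase] P Q by simp
qed

lemma eh_C1_on_abs:
  fixes a b c :: "'a::euclidean_space \<Rightarrow> complex"
  assumes W: "open W"
    and d: "\<And>x. x \<in> W \<Longrightarrow> (a has_derivative a' x) (at x)" "\<And>x. x \<in> W \<Longrightarrow> (b has_derivative b' x) (at x)"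
      "\<And>x. x \<in> W \<Longrightarrow> (c has_derivative c' x) (at x)"
    and cont: "\<And>h. continuous_on W (\<lambda>x. a' x h)" "\<And>h. continuous_on W (\<lambda>x. b' x h)" "\<And>h. continuous_on W (\<lambda>x. c' x h)"
    and nz: "\<And>x. x \<in> W \<Longrightarrow> a x \<noteq> 0 \<or> b x \<noteq> 0"
  shows "eh_C1_on (\<lambda>x. abs_h2 (a x, b x, c x)) W"
proof -
  have abc: "continuous_on W a" "continuous_on W b" "continuous_on W c"
    using d by (meson continuous_at_imp_continuous_on has_derivative_continuous)+
  have "continuous_on W (abs_h2 \<circ> (\<lambda>x. (a x, b x, c x)))"
    by (rule continuous_on_compose[OF _ continuous_on_subset[OF continuous_on_abs_h2]])
       (auto intro!: continuous_intros abc simp: eh_rel_refl_iff dest: nz)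
  moreover have "C1_on (eh_chart k \<circ> (\<lambda>x. abs_h2 (a x, b x, c x))) {x \<in> W. abs_h2 (a x, b x, c x) \<in> eh_dom k}" for k
  proof (cases k)
    case Aff
    have W': "{x \<in> W. abs_h2 (a x, b x, c x) \<in> eh_dom k} = {x \<in> W. b x \<noteq> 0}"
      using eh_dom_abs(1)[OF nz] by (auto simp: Aff simp del: eh_dom.simps)
    have "open {x \<in> W. b x \<noteq> 0}"
      using continuous_open_preimage[OF abc(2) W, of "- {0}"] by (simp add: vimage_def Int_def conj_commute open_Compl)
    then show ?thesis
      unfolding W' unfolding Aff
      by (rule C1_onI[OF _ has_derivative_chart_abs(1)[OF d]])
         (auto intro!: continuous_on_vector2 continuous_intros intro: continuous_on_subset[OF abc(1)]
            continuous_on_subset[OF abc(2)] continuous_on_subset[OF abc(3)]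
            continuous_on_subset[OF cont(1)] continuous_on_subset[OF cont(2)] continuous_on_subset[OF cont(3)])
  next
    case AtInf
    have W': "{x \<in> W. abs_h2 (a x, b x, c x) \<in> eh_dom k} = {x \<in> W. a x \<noteq> 0}"
      using eh_dom_abs(2)[OF nz] by (auto simp: AtInf simp del: eh_dom.simps)
    have "open {x \<in> W. a x \<noteq> 0}"
      using continuous_open_preimage[OF abc(1) W, of "- {0}"] by (simp add: vimage_def Int_def conj_commute open_Compl)
    then show ?thesis
      unfolding W' unfolding AtInf
      by (rule C1_onI[OF _ has_derivative_chart_abs(2)[OF d]])
         (auto intro!: continuous_on_vector2 continuous_intros intro: continuous_on_subset[OF abc(1)]
            continuous_on_subset[OF abc(2)] continuous_on_subset[OF abc(3)]
            continuous_on_subset[OF cont(1)] continuous_on_subset[OF cont(2)] continuous_on_subset[OF cont(3)])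
  qed
  ultimately show ?thesis
    using W by (simp add: eh_C1_on_def comp_def)
qed

section \<open>Growth along curves\<close>

text \<open>The derivative is Henstock-Kurzweil integrable by the fundamental theorem, hence
  measurable. If the right-hand side is finite, domination by \<open>g\<close> makes it Lebesgue
  integrable and the two integrals agree; otherwise the bound is trivial.\<close>

lemma FTC_nn_integral_bound:
  fixes f :: "real \<Rightarrow> real"
  assumes "finite F" "continuous_on {0..1} f"
    and der: "\<And>s. s \<in> {0<..<1} - F \<Longrightarrow> \<exists>D. (f has_real_derivative D) (at s) \<and> \<bar>D\<bar> \<le> g s"
  shows "ennreal \<bar>f 1 - f 0\<bar> \<le> (\<integral>\<^sup>+s\<in>{0..1}. ennreal (g s) \<partial>lborel)"
proof -
  \<comment> \<open>The value 0 at exceptional points keeps the comparison with \<open>g\<close>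
    valid on all of the interval.\<close>
  define D where "D = (\<lambda>s. if s \<in> {0<..<1} - F then deriv f s else 0)"
  have D: "(f has_real_derivative D s) (at s)" "\<bar>D s\<bar> \<le> g s" if "s \<in> {0<..<1} - F" for s
    using der[OF that] that by (auto simp: D_def dest: DERIV_imp_deriv)
  have HK: "(D has_integral (f 1 - f 0)) {0..1}"
    using assms(1,2) D(1)
    by (intro fundamental_theorem_of_calculus_interior_strong[of F])
       (auto simp flip: has_real_derivative_iff_has_vector_derivative)
  have "(\<integral>\<^sup>+s. ennreal (norm (D s)) \<partial>lebesgue_on {0..1}) = (\<integral>\<^sup>+s. ennreal (norm (D s)) * indicator {0..1} s \<partial>lborel)"
    by (simp add: nn_integral_restrict_space nn_integral_completion)
  also have "\<dots> \<le> (\<integral>\<^sup>+s\<in>{0..1}. ennreal (g s) \<partial>lborel)"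
    using D(2) by (intro nn_integral_mono mult_right_mono) (auto simp: D_def ennreal_leI)
  finally have le: "(\<integral>\<^sup>+s. ennreal (norm (D s)) \<partial>lebesgue_on {0..1}) \<le> (\<integral>\<^sup>+s\<in>{0..1}. ennreal (g s) \<partial>lborel)" .
  show ?thesis
  proof (cases "(\<integral>\<^sup>+s\<in>{0..1}. ennreal (g s) \<partial>lborel) = \<infinity>")
    case False
    have "D \<in> borel_measurable (lebesgue_on {0..1})"
      using HK by (intro integrable_imp_measurable) blast
    then have int: "integrable (lebesgue_on {0..1}) D"
      using le False by (auto simp: integrable_iff_bounded top.not_eq_extremum)
    then have "integral\<^sup>L (lebesgue_on {0..1}) D = f 1 - f 0"
      using lebesgue_integral_eq_integral[OF int] HK by (simp add: integral_unique)
    then show ?thesis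
      using integral_norm_bound_ennreal[OF int] le by simp
  qed simp
qed

lemma eh_S_chart:
  assumes "q \<in> eh_dom k"
  shows "eh_S t q = sqrt (usq (eh_chart k q) + t ^ 4)"
  by (simp add: eh_S_def eh_u_chart[OF assms])

lemma eh_chart_has_derivative:
  assumes "eh_C1_on \<phi> W" "x \<in> W" "\<phi> x \<in> eh_dom k"
  shows "(eh_chart k \<circ> \<phi> has_derivative frechet_derivative (eh_chart k \<circ> \<phi>) (at x)) (at x)"
proof -
  have "eh_chart k \<circ> \<phi> differentiable (at x)"
    using assms by (intro C1_on_differentiable[of _ "{x \<in> W. \<phi> x \<in> eh_dom k}"]) (auto simp: eh_C1_on_def)
  then show ?thesis
    by (simp add: frechet_derivative_works)
qed

lemma eventually_eh_dom:
  assumes "eh_C1_on \<phi> W" "x \<in> W" "\<phi> x \<in> eh_dom k"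
  shows "\<forall>\<^sub>F y in nhds x. y \<in> W \<and> \<phi> y \<in> eh_dom k"
proof -
  have "open (W \<inter> \<phi> -` eh_dom k)"
    using assms(1) open_eh_dom by (auto simp: eh_C1_on_def intro!: continuous_open_preimage)
  then show ?thesis
    using assms(2,3) by (simp add: eventually_nhds) (metis IntD1 IntD2 IntI vimageD vimageI)
qed

context
  fixes t :: real assumes t: "t > 0"
begin

lemma eh_S_ge: "t\<^sup>2 \<le> eh_S t q" "eh_u q \<le> eh_S t q"
proof -
  have "t\<^sup>2 = sqrt (t ^ 4)"
    by (rule real_sqrt_unique[symmetric]) auto
  then show "t\<^sup>2 \<le> eh_S t q"
    by (simp add: eh_S_def)
  show "eh_u q \<le> eh_S t q"
    unfolding eh_S_def by (rule real_le_rsqrt) simp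
qed

lemma eh_S_pos: "eh_S t q > 0"
  using eh_S_ge(1)[of q] t by (smt (verit) zero_less_power)

text \<open>The infinitesimal Lipschitz bound. Cauchy-Schwarz gives |d(u^2)| \<le> 4 u |Q|, and u
  \<le> S then gives |d(sqrt S)| \<le> |Q| / sqrt S, which the Q-term of the metric alone
  dominates.\<close>

lemma eh_form_sqrt_S_bound:
  defines "S \<equiv> \<lambda>p. sqrt (usq p + t ^ 4)"
  obtains D where "((\<lambda>p. sqrt (S p)) has_derivative D) (at p)" "\<And>X. \<bar>D X\<bar> \<le> sqrt (eh_form t p X X)"
proof
  define d where "d = (\<lambda>X. 4 * (1 + (cmod (p $ 1))\<^sup>2) * (p $ 2 \<bullet> eh_Q p X))"
  have S: "S p > 0"
    unfolding S_def by (rule sqrt_usq_pos[OF t])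
  have dS: "(S has_derivative (\<lambda>X. d X / (2 * S p))) (at p)"
    unfolding d_def S_def using S[unfolded S_def]
    by (auto intro!: derivative_eq_intros has_derivative_usq simp: field_simps)
  show "((\<lambda>p. sqrt (S p)) has_derivative (\<lambda>X. d X / (2 * S p) / (2 * sqrt (S p)))) (at p)"
    using S by (auto intro!: derivative_eq_intros dS simp: field_simps)
  fix X
  have "\<bar>d X\<bar> \<le> 4 * (1 + (cmod (p $ 1))\<^sup>2) * (cmod (p $ 2) * cmod (eh_Q p X))"
    unfolding d_def abs_mult using Cauchy_Schwarz_ineq2[of "p $ 2" "eh_Q p X"]
    by (intro mult_mono) auto
  also have "\<dots> = 4 * sqrt (usq p) * cmod (eh_Q p X)"
    by (simp add: usq_def real_sqrt_mult)
  also have "\<dots> \<le> 4 * S p * cmod (eh_Q p X)"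
    unfolding S_def using t usq_nonneg[of p] by (intro mult_mono) auto
  finally have "\<bar>d X\<bar> / (4 * S p * sqrt (S p)) \<le> 4 * S p * cmod (eh_Q p X) / (4 * S p * sqrt (S p))"
    using S by (intro divide_right_mono) auto
  then have "\<bar>d X / (2 * S p) / (2 * sqrt (S p))\<bar> \<le> cmod (eh_Q p X) / sqrt (S p)"
    using S by (simp add: abs_mult)
  also have "\<dots> = sqrt (1 / S p * (eh_Q p X \<bullet> eh_Q p X))"
    using S by (simp add: real_sqrt_divide norm_eq_sqrt_inner)
  also have "\<dots> \<le> sqrt (eh_form t p X X)"
  proof -
    have "0 \<le> 2 * S p * (eh_P p X \<bullet> eh_P p X)"
      using S by simp
    moreover have "1 / S p * (eh_Q p X \<bullet> eh_Q p X) \<le> 2 / S p * (eh_Q p X \<bullet> eh_Q p X)"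
      using S by (intro mult_right_mono divide_right_mono) auto
    ultimately show ?thesis
      unfolding eh_form_def S_def by (intro real_sqrt_le_mono) linarith
  qed
  finally show "\<bar>d X / (2 * S p) / (2 * sqrt (S p))\<bar> \<le> sqrt (eh_form t p X X)" .
qed

lemma sqrt_S_curve_bound:
  assumes "eh_curve c"
  shows "ennreal \<bar>sqrt (eh_S t (c 1)) - sqrt (eh_S t (c 0))\<bar> \<le> eh_length t c"
proof -
  obtain F where F: "finite F" "eh_C1_on c ({0<..<1} - F)" and c: "continuous_on {0..1} c"
    using assms by (auto simp: eh_curve_def path_def)
  show ?thesis
    unfolding eh_length_def
  proof (rule FTC_nn_integral_bound[OF F(1)])
    show "continuous_on {0..1} (\<lambda>s. sqrt (eh_S t (c s)))"
      unfolding eh_S_def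
      by (intro continuous_intros continuous_on_compose2[OF continuous_on_eh_u c]) auto
    fix s assume s: "s \<in> {0<..<1} - F"
    define k where "k = eh_index_at (c s)"
    define L where "L = frechet_derivative (eh_chart k \<circ> c) (at s)"
    have k: "c s \<in> eh_dom k"
      unfolding k_def by (rule eh_index_at_dom)
    have L: "(eh_chart k \<circ> c has_derivative L) (at s)"
      unfolding L_def by (rule eh_chart_has_derivative[OF F(2) s k])
    obtain D where D: "((\<lambda>p. sqrt (sqrt (usq p + t ^ 4))) has_derivative D) (at ((eh_chart k \<circ> c) s))"
      "\<And>X. \<bar>D X\<bar> \<le> sqrt (eh_form t ((eh_chart k \<circ> c) s) X X)"
      using eh_form_sqrt_S_bound[of "(eh_chart k \<circ> c) s"] by blast
    have comp: "((\<lambda>s. sqrt (sqrt (usq ((eh_chart k \<circ> c) s) + t ^ 4))) has_derivative (\<lambda>h. D (L h))) (at s)"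
      by (rule has_derivative_compose[OF L D(1)])
    \<comment> \<open>The chart is fixed at \<open>s\<close>, so its expression for
      \<open>eh_S\<close> is valid only near \<open>s\<close>, which suffices for the derivative
      there.\<close>
    have ev: "\<forall>\<^sub>F y in nhds s. sqrt (sqrt (usq ((eh_chart k \<circ> c) y) + t ^ 4)) = sqrt (eh_S t (c y))"
      using eventually_eh_dom[OF F(2) s k] by eventually_elim (simp add: eh_S_chart[of _ k] del: eh_dom.simps)
    from ev have ev': "\<forall>\<^sub>F y in at s. sqrt (sqrt (usq ((eh_chart k \<circ> c) y) + t ^ 4)) = sqrt (eh_S t (c y))"
      unfolding eventually_nhds_conv_at by (rule conjunct1)
    have der: "((\<lambda>s. sqrt (eh_S t (c s))) has_derivative (\<lambda>h. D (L h))) (at s)"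
      by (rule has_derivative_transform_eventually[OF comp ev' eventually_nhds_x_imp_x[OF ev] UNIV_I])
    interpret D: linear D using D(1) by (rule has_derivative_linear)
    interpret L: linear L using L by (rule has_derivative_linear)
    have "(\<lambda>h. D (L h)) = (*) (D (L 1))"
    proof
      fix h
      show "D (L h) = D (L 1) * h"
        using L.scale[of h 1] D.scale[of h "L 1"] by simp
    qed
    with der have "((\<lambda>s. sqrt (eh_S t (c s))) has_real_derivative D (L 1)) (at s)"
      unfolding has_field_derivative_def by simp
    moreover have "\<bar>D (L 1)\<bar> \<le> sqrt (eh_pullback t c s 1 1)"
      using D(2)[of "L 1"]
      by (simp add: eh_pullback_def eh_metric_eq_form[OF t] eh_deriv_def L_def k_def comp_def)
    ultimately show "\<exists>D. ((\<lambda>s. sqrt (eh_S t (c s))) has_real_derivative D) (at s) \<and> \<bar>D\<bar> \<le> sqrt (eh_pullback t c s 1 1)"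
      by blast
  qed
qed

lemma eh_S_ball_bound:
  assumes "q \<in> eh_ball t M q\<^sub>0 R" "R \<ge> 0"
  shows "eh_S t q \<le> (sqrt (eh_S t q\<^sub>0) + R)\<^sup>2"
proof -
  obtain c where c: "eh_curve c" "pathstart c = q\<^sub>0" "pathfinish c = q" "eh_length t c < ennreal R"
    using assms(1) by (auto simp: eh_ball_def eh_dist_def INF_less_iff)
  have "ennreal \<bar>sqrt (eh_S t q) - sqrt (eh_S t q\<^sub>0)\<bar> < ennreal R"
    using sqrt_S_curve_bound[OF c(1)] c(2-4) by (auto simp: pathstart_def pathfinish_def)
  then have "sqrt (eh_S t q) \<le> sqrt (eh_S t q\<^sub>0) + R"
    using assms(2) by (simp add: ennreal_less_iff)
  then have "(sqrt (eh_S t q))\<^sup>2 \<le> (sqrt (eh_S t q\<^sub>0) + R)\<^sup>2"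
    using eh_S_pos[of q] by (intro power_mono) auto
  then show ?thesis
    using eh_S_pos[of q] by simp
qed

end

section \<open>Parametrisation of the preimage of a circle\<close>

lemma cmod_eq_1I: "e * cnj e = 1 \<Longrightarrow> cmod e = 1"
proof -
  assume "e * cnj e = 1"
  then have "complex_of_real ((cmod e)\<^sup>2) = 1"
    by (simp add: norm_power2_complex)
  then have "(cmod e)\<^sup>2 = 1"
    by (simp only: of_real_eq_1_iff)
  then show ?thesis
    using norm_ge_zero[of e] by (auto simp: power2_eq_1_iff)
qed

text \<open>The matrix \<open>(a, b; c, d)\<close> is the element of \<open>U(2)\<close>.\<close>

locale eh_circle =
  fixes r t :: real and a b c d :: complex
  assumes r: "r > 0" and t: "t > 0"
    and col: "a * cnj a + c * cnj c = 1" "b * cnj b + d * cnj d = 1" "cnj a * b + cnj c * d = 0"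
begin

lemma one_plus_r2: "1 + r\<^sup>2 > 0"
  by (smt (verit) zero_le_power2)

lemma col_conj: "a * cnj b + c * cnj d = 0"
  using arg_cong[OF col(3), of cnj] by (simp add: mult.commute)

definition circ :: "real ^ 3 \<Rightarrow> complex" where
  "circ x = of_real r * exp (\<i> * of_real (x $ 1))"

definition fib :: "real ^ 3 \<Rightarrow> complex" where
  "fib x = of_real (x $ 2) + \<i> * of_real (x $ 3)"

text \<open>The angle is unrestricted, so \<open>par\<close> reaches the whole submanifold but is
  injective only on strips of width 2 pi. The fibre coordinate refers to a homogeneous vector of
  constant norm, whence u is proportional to its modulus.\<close>

definition par :: "real ^ 3 \<Rightarrow> h2" where
  "par x = abs_h2 (a * circ x + b, c * circ x + d, fib x)"

lemma circ_cnj: "circ x * cnj (circ x) = of_real (r\<^sup>2)"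
proof -
  have "circ x * cnj (circ x) = of_real ((cmod (circ x))\<^sup>2)"
    by (simp add: norm_power2_complex)
  also have "cmod (circ x) = r"
    using r by (simp add: circ_def norm_mult)
  finally show ?thesis .
qed

text \<open>The vector is the image of (\<zeta>, 1) under a unitary matrix, and |\<zeta>| =
  r.\<close>

lemma par_norm: "(a * circ x + b) * cnj (a * circ x + b) + (c * circ x + d) * cnj (c * circ x + d) = of_real (1 + r\<^sup>2)"
proof -
  from col_conj col circ_cnj[of x] show ?thesis
    unfolding complex_cnj_add complex_cnj_mult of_real_add of_real_1 by algebra
qed

lemma par_nz: "a * circ x + b \<noteq> 0 \<or> c * circ x + d \<noteq> 0"
proof (rule ccontr)
  assume "\<not> ?thesis"
  then have "complex_of_real (1 + r\<^sup>2) = 0"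
    using par_norm[of x] by simp
  moreover have "1 + r\<^sup>2 \<noteq> 0"
    using one_plus_r2 by simp
  ultimately show False
    by (metis of_real_eq_0_iff)
qed

lemma det_unit: "(a * d - b * c) * cnj (a * d - b * c) = 1"
proof -
  from col_conj col show ?thesis
    unfolding complex_cnj_diff complex_cnj_mult by algebra
qed

lemma has_derivative_circ:
  "(circ has_derivative (\<lambda>h. \<i> * circ x * of_real (h $ 1))) (at x)"
proof -
  have "((\<lambda>x. \<i> * complex_of_real (x $ 1)) has_derivative (\<lambda>h. \<i> * of_real (h $ 1))) (at x)"
    by (auto intro!: derivative_eq_intros)
  from has_derivative_mult_right[OF has_derivative_compose[OF this
        DERIV_exp[THEN has_field_derivative_imp_has_derivative]], of "of_real r"]
  show ?thesis
    by (simp add: circ_def[abs_def] mult_ac)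
qed

lemma has_derivative_fib: "(fib has_derivative fib) (at x)"
  unfolding fib_def[abs_def] by (auto intro!: derivative_eq_intros)

lemma has_derivative_par:
  "((\<lambda>x. a * circ x + b) has_derivative (\<lambda>h. a * (\<i> * circ x * of_real (h $ 1)))) (at x)"
  "((\<lambda>x. c * circ x + d) has_derivative (\<lambda>h. c * (\<i> * circ x * of_real (h $ 1)))) (at x)"
  by (auto intro!: derivative_eq_intros has_derivative_circ)

lemma continuous_on_circ: "continuous_on A circ"
  unfolding circ_def[abs_def] by (intro continuous_intros)

lemma continuous_on_fib: "continuous_on A fib"
  unfolding fib_def[abs_def] by (intro continuous_intros)

lemma eh_u_par: "eh_u (par x) = cmod (fib x) * (1 + r\<^sup>2)"
proof -
  have "complex_of_real ((cmod (a * circ x + b))\<^sup>2 + (cmod (c * circ x + d))\<^sup>2) = of_real (1 + r\<^sup>2)"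
    using par_norm[of x] unfolding of_real_add of_real_power norm_power2_complex by simp
  then have "(cmod (a * circ x + b))\<^sup>2 + (cmod (c * circ x + d))\<^sup>2 = 1 + r\<^sup>2"
    by (simp only: of_real_eq_iff)
  then show ?thesis
    by (simp add: par_def eh_u_abs[OF par_nz])
qed

text \<open>\<open>hom_Q\<close> along \<open>par\<close>. The second term is a connection term:
  moving along the circle contributes an infinitesimal rotation of the fibre.\<close>

definition par_Q :: "real ^ 3 \<Rightarrow> real ^ 3 \<Rightarrow> complex" where
  "par_Q x h = of_real ((1 + r\<^sup>2) / 2) * fib h + \<i> * of_real (r\<^sup>2 * h $ 1) * fib x"

text \<open>The induced metric in the parameters. As \<open>eh_S\<close> along \<open>par\<close>
  depends only on the fibre coordinate, it is the same for every unitary matrix.\<close>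

definition par_form :: "real ^ 3 \<Rightarrow> real ^ 3 \<Rightarrow> real ^ 3 \<Rightarrow> real" where
  "par_form x v w = 2 * eh_S t (par x) * ((r / (1 + r\<^sup>2))\<^sup>2 * v $ 1 * w $ 1)
     + 2 / eh_S t (par x) * (par_Q x v \<bullet> par_Q x w)"

text \<open>Split into a phase and a real number. The first factor has modulus 1 because
  |\<open>circ x\<close>| = r and the determinant of a unitary matrix is a unit.\<close>

lemma hom_P_par:
  "hom_P (a * circ x + b) (c * circ x + d) (a * (\<i> * circ x * of_real v)) (c * (\<i> * circ x * of_real v))
   = (\<i> * (circ x / of_real r) * (a * d - b * c)) * of_real (r / (1 + r\<^sup>2) * v)"
proof -
  have "a * (\<i> * circ x * of_real v) * (c * circ x + d) - (a * circ x + b) * (c * (\<i> * circ x * of_real v))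
     = \<i> * circ x * (a * d - b * c) * of_real v"
    by algebra
  then show ?thesis
    unfolding hom_P_def par_norm using r by (simp add: divide_simps)
qed

lemma hom_Q_par:
  "hom_Q (a * circ x + b) (c * circ x + d) (fib x) (a * (\<i> * circ x * of_real (v $ 1))) (c * (\<i> * circ x * of_real (v $ 1))) (fib v)
   = par_Q x v"
proof -
  have "cnj (a * circ x + b) * (a * (\<i> * circ x * of_real (v $ 1))) + cnj (c * circ x + d) * (c * (\<i> * circ x * of_real (v $ 1)))
    = \<i> * of_real (v $ 1) * of_real (r\<^sup>2)"
  proof -
    show ?thesis
      using col_conj col circ_cnj[of x] unfolding complex_cnj_add complex_cnj_mult by algebra
  qed
  then show ?thesis
    unfolding hom_Q_def par_norm par_Q_def by (simp add: algebra_simps)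
qed

text \<open>Stated for compositions so that it serves both straight segments in the parameter space
  and arbitrary parametrisations factored through \<open>par\<close>.\<close>

lemma eh_pullback_par_compose:
  fixes l :: "'a::real_normed_vector \<Rightarrow> real ^ 3"
  assumes l: "(l has_derivative l') (at s)"
  shows "eh_pullback t (\<lambda>s. par (l s)) s v w = par_form (l s) (l' v) (l' w)"
proof -
  let ?e = "\<i> * (circ (l s) / of_real r) * (a * d - b * c)"
  have "cmod (circ (l s)) = r"
    using r by (simp add: circ_def norm_mult)
  moreover have "cmod (a * d - b * c) = 1"
    by (rule cmod_eq_1I) (rule det_unit)
  ultimately have e: "cmod ?e = 1"
    using r by (simp add: norm_mult norm_divide)
  have inner: "of_real x \<bullet> (of_real y :: complex) = x * y" for x y
    by (simp add: inner_complex_def)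
  note D = has_derivative_compose[OF l has_derivative_par(1)] has_derivative_compose[OF l has_derivative_par(2)]
    has_derivative_compose[OF l has_derivative_fib]
  show ?thesis
    unfolding par_def[abs_def]
    unfolding eh_pullback_abs[OF t D par_nz]
    unfolding hom_P_par hom_Q_par e[THEN inner_phase] inner par_form_def par_def[symmetric]
    by (simp add: power2_eq_square)
qed

lemma eh_pullback_par:
  shows "eh_pullback t par x v w = par_form x v w"
  using eh_pullback_par_compose[OF has_derivative_ident, of x v w] by simp

lemma par_form_zero:
  assumes 0: "par_form x v v = 0"
  shows "v = 0"
proof -
  have S: "eh_S t (par x) > 0" by (rule eh_S_pos[OF t])
  have "0 \<le> 2 * eh_S t (par x) * ((r / (1 + r\<^sup>2))\<^sup>2 * v $ 1 * v $ 1)"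
    using S by (simp add: mult.assoc)
  moreover have "0 \<le> 2 / eh_S t (par x) * (par_Q x v \<bullet> par_Q x v)"
    using S by simp
  ultimately have "2 * eh_S t (par x) * ((r / (1 + r\<^sup>2))\<^sup>2 * v $ 1 * v $ 1) = 0"
    "2 / eh_S t (par x) * (par_Q x v \<bullet> par_Q x v) = 0"
    using 0 unfolding par_form_def by linarith+
  moreover have "1 + r\<^sup>2 \<noteq> 0"
    using one_plus_r2 by simp
  ultimately have v1: "v $ 1 = 0" and pQ: "par_Q x v = 0"
    using S r by auto
  have "complex_of_real ((1 + r\<^sup>2) / 2) * fib v = 0"
    using pQ unfolding par_Q_def v1 mult_zero_right of_real_0 mult_zero_left add_0_right .
  moreover have "complex_of_real ((1 + r\<^sup>2) / 2) \<noteq> 0"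
    using \<open>1 + r\<^sup>2 \<noteq> 0\<close> unfolding of_real_eq_0_iff by (simp only: divide_eq_0_iff) simp
  ultimately have "fib v = 0"
    unfolding mult_eq_0_iff by blast
  then have "v $ 2 = 0" "v $ 3 = 0"
    by (auto simp: fib_def complex_eq_iff)
  with v1 show ?thesis
    by (simp add: vec_eq_iff forall_3)
qed

text \<open>The connection term acts as a shear, so the fibre coordinates cancel: the determinant is
  that of a diagonal metric with entries \<open>m\<close>, \<open>k * p\<^sup>2\<close>,
  \<open>k * p\<^sup>2\<close>.\<close>

lemma det_par_form:
  shows "det ((\<chi> i j. par_form x (axis i 1) (axis j 1)) :: real ^ 3 ^ 3)
    = (r * (1 + r\<^sup>2))\<^sup>2 / (2 * eh_S t (par x))"
proof -
  define S N y z where "S = eh_S t (par x)" and "N = 1 + r\<^sup>2" and "y = x $ 2" and "z = x $ 3"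
  have S: "S > 0"
    unfolding S_def by (rule eh_S_pos[OF t])
  have N: "N > 0"
    unfolding N_def by (rule one_plus_r2)
  have Q: "par_Q x (axis 1 1) = Complex (- r\<^sup>2 * z) (r\<^sup>2 * y)"
    "par_Q x (axis 2 1) = Complex (N / 2) 0"
    "par_Q x (axis 3 1) = Complex 0 (N / 2)"
    by (simp_all add: par_Q_def fib_def axis_def N_def complex_eq_iff y_def z_def)
  define k p m where "k = 2 / S" and "p = N / 2" and "m = 2 * S * (r / N)\<^sup>2"
  have M: "par_form x (axis i 1) (axis j 1) = m * axis i 1 $ 1 * axis j 1 $ 1 + k * (par_Q x (axis i 1) \<bullet> par_Q x (axis j 1))" for i j
    by (simp add: par_form_def k_def m_def S_def N_def)
  have "det ((\<chi> i j. par_form x (axis i 1) (axis j 1)) :: real ^ 3 ^ 3)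
     = (m + k * ((r\<^sup>2 * z)\<^sup>2 + (r\<^sup>2 * y)\<^sup>2)) * (k * p\<^sup>2) * (k * p\<^sup>2)
      - (k * p * r\<^sup>2 * z)\<^sup>2 * (k * p\<^sup>2) - (k * p * r\<^sup>2 * y)\<^sup>2 * (k * p\<^sup>2)"
    unfolding det_3 vec_lambda_beta M Q by (simp add: axis_def inner_complex_def p_def power2_eq_square algebra_simps)
  also have "\<dots> = m * (k * p\<^sup>2)\<^sup>2"
    by (simp add: power2_eq_square algebra_simps)
  also have "\<dots> = (r * N)\<^sup>2 / (2 * S)"
    using S N by (simp add: m_def k_def p_def power2_eq_square field_simps)
  finally show ?thesis
    by (simp add: S_def N_def)
qed

lemma eh_volume_density_par:
  shows "eh_volume_density t par x = r * (1 + r\<^sup>2) / sqrt (2 * eh_S t (par x))"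
  unfolding eh_volume_density_def eh_pullback_par det_par_form
  unfolding real_sqrt_divide real_sqrt_abs using r by (simp add: abs_mult)

section \<open>Injectivity and regularity of the parametrisation\<close>

lemma par_eq_iff: "par x = par y \<longleftrightarrow> circ x = circ y \<and> fib x = fib y"
proof
  assume "par x = par y"
  then have "eh_rel (a * circ x + b, c * circ x + d, fib x) (a * circ y + b, c * circ y + d, fib y)"
    unfolding par_def using par_nz by (subst (asm) abs_h2_eq_iff) (auto simp: eh_rel_refl_iff)
  then obtain A where A: "a * circ y + b = A * (a * circ x + b)" "c * circ y + d = A * (c * circ x + d)"
    "fib y = fib x / A\<^sup>2"
    by (auto simp: eh_rel_def)
  \<comment> \<open>Pairing with the second column of the unitary matrix extracts the coordinate 1
    of (\<zeta>, 1) on both sides; the first column extracts \<zeta> below.\<close>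
  have "A = 1"
  proof -
    have "cnj b * (a * circ y + b) + cnj d * (c * circ y + d) = A * (cnj b * (a * circ x + b) + cnj d * (c * circ x + d))"
      unfolding A by algebra
    then show ?thesis
      using col_conj col by algebra
  qed
  moreover have "circ y = A * circ x"
  proof -
    have "cnj a * (a * circ y + b) + cnj c * (c * circ y + d) = A * (cnj a * (a * circ x + b) + cnj c * (c * circ x + d))"
      unfolding A by algebra
    then show ?thesis
      using col by algebra
  qed
  ultimately show "circ x = circ y \<and> fib x = fib y"
    using A(3) by simp
qed (simp add: par_def)

lemma fib_eq_iff: "fib x = fib y \<longleftrightarrow> x $ 2 = y $ 2 \<and> x $ 3 = y $ 3"
  by (auto simp: fib_def complex_eq_iff)

lemma inj_on_par: "inj_on par {x. \<alpha> < x $ 1 \<and> x $ 1 < \<alpha> + 2 * pi}"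
proof (rule inj_onI)
  fix x y assume x: "x \<in> {x. \<alpha> < x $ 1 \<and> x $ 1 < \<alpha> + 2 * pi}" and y: "y \<in> {x. \<alpha> < x $ 1 \<and> x $ 1 < \<alpha> + 2 * pi}"
    and eq: "par x = par y"
  have "exp (\<i> * of_real (x $ 1)) = exp (\<i> * of_real (y $ 1))"
    using eq r by (simp add: par_eq_iff circ_def)
  then obtain n :: int where "\<i> * of_real (x $ 1) = \<i> * of_real (y $ 1) + of_real (2 * of_int n * pi) * \<i>"
    by (auto simp: exp_eq)
  from arg_cong[OF this, of Im] have n: "x $ 1 = y $ 1 + 2 * of_int n * pi"
    by simp
  have "n = 0"
  proof (rule ccontr)
    assume "n \<noteq> 0"
    then have "1 \<le> \<bar>real_of_int n\<bar>" by linarith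
    then have "2 * pi * 1 \<le> 2 * pi * \<bar>real_of_int n\<bar>"
      by (intro mult_left_mono) auto
    also have "\<dots> = \<bar>x $ 1 - y $ 1\<bar>"
      using n by (simp add: abs_mult)
    finally show False
      using x y by auto
  qed
  then show "x = y"
    using n eq by (simp add: par_eq_iff fib_eq_iff vec_eq_iff forall_3)
qed

lemma eh_C1_on_par_compose:
  fixes l :: "'a::euclidean_space \<Rightarrow> real ^ 3"
  assumes "open W" "\<And>x. x \<in> W \<Longrightarrow> (l has_derivative l') (at x)"
  shows "eh_C1_on (\<lambda>x. par (l x)) W"
  unfolding par_def[abs_def]
proof (rule eh_C1_on_abs[OF assms(1)])
  fix x assume "x \<in> W"
  note l = assms(2)[OF this]
  show "((\<lambda>x. a * circ (l x) + b) has_derivative (\<lambda>h. a * (\<i> * circ (l x) * of_real (l' h $ 1)))) (at x)"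
    "((\<lambda>x. c * circ (l x) + d) has_derivative (\<lambda>h. c * (\<i> * circ (l x) * of_real (l' h $ 1)))) (at x)"
    "((\<lambda>x. fib (l x)) has_derivative (\<lambda>h. fib (l' h))) (at x)"
    by (rule has_derivative_compose[OF l has_derivative_par(1)] has_derivative_compose[OF l has_derivative_par(2)]
      has_derivative_compose[OF l has_derivative_fib])+
next
  have l: "continuous_on W l"
    using assms(2) by (meson continuous_at_imp_continuous_on has_derivative_continuous)
  show "continuous_on W (\<lambda>x. a * (\<i> * circ (l x) * of_real (l' h $ 1)))"
    "continuous_on W (\<lambda>x. c * (\<i> * circ (l x) * of_real (l' h $ 1)))" "continuous_on W (\<lambda>x. fib (l' h))" for h
    by (auto intro!: continuous_intros continuous_on_compose2[OF continuous_on_circ l])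
qed (rule par_nz)

text \<open>The derivative is injective because a kernel vector would have length 0 in the definite
  form \<open>par_form\<close>.\<close>

lemma eh_parametrization_par:
  assumes "range par \<subseteq> M"
  shows "eh_parametrization M par {x. \<alpha> < x $ 1 \<and> x $ 1 < \<alpha> + 2 * pi}"
  unfolding eh_parametrization_def
proof (intro conjI ballI)
  have "{x :: real ^ 3. \<alpha> < x $ 1 \<and> x $ 1 < \<alpha> + 2 * pi} = {x. \<alpha> < x $ 1} \<inter> {x. x $ 1 < \<alpha> + 2 * pi}"
    by auto
  then have op: "open {x :: real ^ 3. \<alpha> < x $ 1 \<and> x $ 1 < \<alpha> + 2 * pi}"
    by (auto intro!: open_Int open_Collect_less continuous_intros)
  then show C1: "eh_C1_on par {x. \<alpha> < x $ 1 \<and> x $ 1 < \<alpha> + 2 * pi}"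
    using eh_C1_on_par_compose[of _ "\<lambda>x. x" "\<lambda>x. x"] by simp
  fix x assume x: "x \<in> {x :: real ^ 3. \<alpha> < x $ 1 \<and> x $ 1 < \<alpha> + 2 * pi}"
  have "(eh_chart (eh_index_at (par x)) \<circ> par has_derivative eh_deriv par x) (at x)"
    unfolding eh_deriv_def using eh_chart_has_derivative[OF C1 x eh_index_at_dom] by simp
  then have lin: "linear (eh_deriv par x)"
    by (rule has_derivative_linear)
  show "inj (eh_deriv par x)"
    unfolding linear_injective_0[OF lin]
  proof (intro allI impI)
    fix v assume "eh_deriv par x v = 0"
    then have "eh_pullback t par x v v = 0"
      by (simp add: eh_pullback_def eh_metric_eq_form[OF t] eh_form_def)
    then show "v = 0"
      using par_form_zero by (simp add: eh_pullback_par)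
  qed
next
  show "par ` {x. \<alpha> < x $ 1 \<and> x $ 1 < \<alpha> + 2 * pi} \<subseteq> M"
    using assms by blast
qed (rule inj_on_par)

end

section \<open>Upper volume bound\<close>

lemma emeasure_centered_cube:
  fixes m :: real
  assumes "m \<ge> 0"
  shows "emeasure lborel (cbox (\<chi> i. - m) (\<chi> i. m) :: (real ^ 3) set) = ennreal ((2 * m) ^ 3)" (is "emeasure _ ?box = _")
proof -
  have "?box \<noteq> {}"
    using assms by (simp add: interval_ne_empty_cart)
  then have "measure lborel ?box = (2 * m) ^ 3"
    by (subst content_cbox_cart) auto
  moreover have "emeasure lborel ?box \<noteq> top"
    using emeasure_bounded_finite[OF bounded_cbox] by (metis less_irrefl infinity_ennreal_def)
  ultimately show ?thesis
    by (simp add: emeasure_eq_ennreal_measure)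
qed

context eh_circle
begin

section \<open>Distances between parametrised points\<close>

lemma eh_S_par: "eh_S t (par x) = sqrt ((cmod (fib x) * (1 + r\<^sup>2))\<^sup>2 + t ^ 4)"
  unfolding eh_S_def eh_u_par ..

lemma continuous_on_eh_S_par:
  assumes "continuous_on A f"
  shows "continuous_on A (\<lambda>x. eh_S t (par (f x)))"
  unfolding eh_S_par
  by (intro continuous_intros continuous_on_compose2[OF continuous_on_fib[of UNIV] assms] subset_UNIV)

lemma continuous_on_par_form:
  assumes f: "continuous_on A f" and g: "continuous_on A g"
  shows "continuous_on A (\<lambda>x. par_form (f x) (g x) (g x))"
proof -
  have "\<forall>x\<in>A. eh_S t (par (f x)) \<noteq> 0"
    using eh_S_pos[OF t] by (metis less_irrefl)
  then show ?thesis
    unfolding par_form_def par_Q_def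
    by (intro continuous_intros continuous_on_eh_S_par f g continuous_on_compose2[OF continuous_on_fib[of UNIV] f]
      continuous_on_compose2[OF continuous_on_fib[of UNIV] g] subset_UNIV)
qed

lemma par_form_bounded:
  obtains K where "\<And>x v. x \<in> cball 0 \<rho> \<Longrightarrow> v \<in> cball 0 \<rho>' \<Longrightarrow> par_form x v v \<le> K"
proof -
  have "continuous_on (cball 0 \<rho> \<times> cball 0 \<rho>') (\<lambda>z. par_form (fst z) (snd z) (snd z))"
    by (intro continuous_on_par_form continuous_intros)
  then have "compact ((\<lambda>z. par_form (fst z) (snd z) (snd z)) ` (cball 0 \<rho> \<times> cball 0 \<rho>'))"
    by (intro compact_continuous_image compact_Times compact_cball)
  from compact_imp_bounded[OF this] obtain K where
    K: "\<forall>y\<in>(\<lambda>z. par_form (fst z) (snd z) (snd z)) ` (cball 0 \<rho> \<times> cball 0 \<rho>'). norm y \<le> K"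
    unfolding bounded_iff by blast
  have "par_form x v v \<le> K" if "x \<in> cball 0 \<rho>" "v \<in> cball 0 \<rho>'" for x v
  proof -
    have "(x, v) \<in> cball 0 \<rho> \<times> cball 0 \<rho>'"
      using that by blast
    from K[rule_format, OF imageI[OF this]] show ?thesis
      by simp
  qed
  then show ?thesis
    by (rule that)
qed

text \<open>Join the parameters by a straight segment; the parameter ball is convex and compact, so
  the speed is bounded. This places a fixed compact piece inside all large geodesic balls.\<close>

lemma eh_dist_par_bounded:
  assumes M: "range par \<subseteq> M"
  obtains K :: real where "K \<ge> 0" "\<And>x y. x \<in> cball 0 \<rho> \<Longrightarrow> y \<in> cball 0 \<rho> \<Longrightarrow> eh_dist t M (par x) (par y) \<le> ennreal K"
proof -
  obtain K where K: "\<And>x v. x \<in> cball 0 \<rho> \<Longrightarrow> v \<in> cball 0 (2 * \<rho>) \<Longrightarrow> par_form x v v \<le> K"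
    using par_form_bounded[of \<rho> "2 * \<rho>"] by blast
  have "eh_dist t M (par x) (par y) \<le> ennreal (sqrt \<bar>K\<bar>)" if x: "x \<in> cball 0 \<rho>" and y: "y \<in> cball 0 \<rho>" for x y
  proof -
    define l where "l = (\<lambda>s :: real. x + s *\<^sub>R (y - x))"
    have l: "(l has_derivative (\<lambda>h. h *\<^sub>R (y - x))) (at s)" for s
      unfolding l_def by (auto intro!: derivative_eq_intros)
    have C1: "eh_C1_on (\<lambda>s. par (l s)) UNIV"
      using l by (intro eh_C1_on_par_compose) auto
    have "eh_C1_on (\<lambda>s. par (l s)) ({0<..<1} - {})"
      using l by (intro eh_C1_on_par_compose) auto
    then have curve: "eh_curve (\<lambda>s. par (l s))"
      using C1 unfolding eh_curve_def path_def eh_C1_on_def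
      by (meson continuous_on_subset finite.emptyI subset_UNIV)
    have "eh_length t (\<lambda>s. par (l s)) \<le> (\<integral>\<^sup>+s. ennreal (sqrt \<bar>K\<bar>) * indicator {0..1 :: real} s \<partial>lborel)"
      unfolding eh_length_def
    proof (intro nn_integral_mono)
      fix s :: real
      show "ennreal (sqrt (eh_pullback t (\<lambda>s. par (l s)) s 1 1)) * indicator {0..1} s \<le> ennreal (sqrt \<bar>K\<bar>) * indicator {0..1} s"
      proof (cases "s \<in> {0..1}")
        case True
        have "l s = (1 - s) *\<^sub>R x + s *\<^sub>R y"
          by (simp add: l_def algebra_simps)
        then have "l s \<in> cball 0 \<rho>"
          using convexD[OF convex_cball x y, of "1 - s" s] True by simp
        moreover have "norm (y - x) \<le> 2 * \<rho>"
          using x y norm_triangle_ineq4[of y x] by simp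
        ultimately have "par_form (l s) (y - x) (y - x) \<le> \<bar>K\<bar>"
          using K[of "l s" "y - x"] by simp
        then show ?thesis
          using True by (simp add: eh_pullback_par_compose[OF l] ennreal_leI)
      qed simp
    qed
    also have "\<dots> = ennreal (sqrt \<bar>K\<bar>)"
      by (simp add: nn_integral_cmult_indicator)
    finally have len: "eh_length t (\<lambda>s. par (l s)) \<le> ennreal (sqrt \<bar>K\<bar>)" .
    have "(\<lambda>s. par (l s)) \<in> {c. eh_curve c \<and> path_image c \<subseteq> M \<and> pathstart c = par x \<and> pathfinish c = par y}"
      using curve M by (auto simp: path_image_def pathstart_def pathfinish_def l_def)
    then have "eh_dist t M (par x) (par y) \<le> eh_length t (\<lambda>s. par (l s))"
      unfolding eh_dist_def by (rule INF_lower)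
    from this len show ?thesis
      by (rule order_trans)
  qed
  then show ?thesis
    by (intro that[of "sqrt \<bar>K\<bar>"]) auto
qed

section \<open>The parametrisation covers the preimage of the circle\<close>

lemma cmod_circ: "cmod (circ x) = r"
  using r by (simp add: circ_def norm_mult)

lemma range_par_eq: "range par = M3 ((\<lambda>z. moebius (vector [vector [a, b], vector [c, d]]) (Some z)) ` sphere 0 r)"
  (is "_ = M3 (?m ` _)")
proof (intro equalityI subsetI)
  fix q assume "q \<in> range par"
  then obtain x where q: "q = par x" by blast
  have "eh_proj q = ?m (circ x)"
    unfolding q par_def eh_proj_abs[OF par_nz] by (simp add: vector_2)
  moreover have "circ x \<in> sphere 0 r"
    by (simp add: cmod_circ)
  ultimately show "q \<in> M3 (?m ` sphere 0 r)"
    unfolding M3_def by blast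
next
  fix q assume "q \<in> M3 (?m ` sphere 0 r)"
  then obtain z where z: "cmod z = r" "eh_proj q = ?m z"
    by (auto simp: M3_def)
  obtain \<alpha> \<beta> \<gamma> where q: "q = abs_h2 (\<alpha>, \<beta>, \<gamma>)" and nz: "\<alpha> \<noteq> 0 \<or> \<beta> \<noteq> 0"
    by (rule h2_cases)
  \<comment> \<open>An auxiliary parameter with the angle of \<open>z\<close>, used to transfer
    \<open>par_nz\<close> to \<open>z\<close>.\<close>
  define x0 :: "real ^ 3" where "x0 = vector [Arg z, 0, 0]"
  have "z = rcis r (Arg z)"
    using rcis_cmod_Arg[of z] z(1) by simp
  then have circ0: "circ x = z" if "x $ 1 = Arg z" for x
    using that by (simp add: circ_def rcis_def cis_conv_exp)
  have c0: "circ x0 = z"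
    by (rule circ0) (simp add: x0_def)
  from par_nz[of x0] have nz': "a * z + b \<noteq> 0 \<or> c * z + d \<noteq> 0"
    unfolding c0 .
  \<comment> \<open>Both homogeneous vectors represent the same point of the projective line;
    \<open>A\<close> is their ratio, read off from a coordinate that does not vanish. Dividing
    \<gamma> by its square then keeps the class.\<close>
  obtain A where A: "A \<noteq> 0" "a * z + b = A * \<alpha>" "c * z + d = A * \<beta>"
  proof (cases "c * z + d = 0")
    case True
    with z(2) nz have "\<beta> = 0"
      unfolding q eh_proj_abs[OF nz] by (auto simp: vector_2 split: if_splits)
    with nz nz' True show ?thesis
      by (intro that[of "(a * z + b) / \<alpha>"]) auto
  next
    case False
    with z(2) nz have "\<beta> \<noteq> 0" and e: "\<alpha> / \<beta> = (a * z + b) / (c * z + d)"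
      unfolding q eh_proj_abs[OF nz] by (auto simp: vector_2 split: if_splits)
    have "a * z + b = (\<alpha> / \<beta>) * (c * z + d)"
      unfolding e using False by simp
    with \<open>\<beta> \<noteq> 0\<close> False show ?thesis
      by (intro that[of "(c * z + d) / \<beta>"]) auto
  qed
  define x :: "real ^ 3" where "x = vector [Arg z, Re (\<gamma> / A\<^sup>2), Im (\<gamma> / A\<^sup>2)]"
  have x: "circ x = z" "fib x = \<gamma> / A\<^sup>2"
    by (auto simp: x_def circ0 fib_def complex_eq_iff)
  have "q = par x"
    unfolding q par_def x
  proof (subst abs_h2_eq_iff)
    show "eh_rel (\<alpha>, \<beta>, \<gamma>) (a * z + b, c * z + d, \<gamma> / A\<^sup>2)"
      using nz nz' A unfolding eh_rel_def by (auto intro!: exI[of _ A])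
  qed (use nz nz' in \<open>auto simp: eh_rel_refl_iff\<close>)
  then show "q \<in> range par"
    by blast
qed

text \<open>\<open>Arg\<close> takes values in (-pi, pi]; the end point pi, missing from the first
  open strip, lies in the second.\<close>

lemma par_surj_strips:
  obtains y where "par y = par x" "- pi < y $ 1" "y $ 1 < pi" | y where "par y = par x" "0 < y $ 1" "y $ 1 < 2 * pi"
proof -
  define y :: "real ^ 3" where "y = vector [Arg (circ x), x $ 2, x $ 3]"
  have y: "y $ 1 = Arg (circ x)" "y $ 2 = x $ 2" "y $ 3 = x $ 3"
    by (simp_all add: y_def)
  have "circ y = rcis (cmod (circ x)) (Arg (circ x))"
    unfolding circ_def[of y] y cmod_circ by (simp add: rcis_def cis_conv_exp)
  then have "par y = par x"
    by (simp add: par_eq_iff rcis_cmod_Arg fib_eq_iff y)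
  moreover have "- pi < y $ 1" "y $ 1 \<le> pi"
    using Arg_bounded[of "circ x"] by (auto simp: y)
  ultimately show ?thesis
    using that pi_gt_zero by (cases "y $ 1 = pi") fastforce+
qed

lemma eh_volume_upper:
  assumes M: "M = range par" and B: "B \<subseteq> M" and G: "\<And>q. q \<in> B \<Longrightarrow> eh_S t q \<le> G" and "G \<ge> 0"
  shows "eh_volume t M B \<le> ennreal (2 * (r * (1 + r\<^sup>2) / sqrt (2 * t\<^sup>2)) * (2 * (2 * pi + G)) ^ 3)"
proof -
  \<comment> \<open>The density formula evaluated at S = t^2, the lower bound of S, hence an upper
    bound for the density.\<close>
  define D where "D = r * (1 + r\<^sup>2) / sqrt (2 * t\<^sup>2)"
  \<comment> \<open>Large enough for the angle, at most 2 pi in modulus, and for the fibre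
    coordinates, at most G, so that one cube contains all parameters.\<close>
  define m where "m = 2 * pi + G"
  define U where "U = (\<lambda>n :: nat. {x :: real ^ 3. (if n = 0 then - pi else 0) < x $ 1 \<and> x $ 1 < (if n = 0 then - pi else 0) + 2 * pi})"
  define box :: "(real ^ 3) set" where "box = cbox (\<chi> i. - m) (\<chi> i. m)"
  \<comment> \<open>Two strips suffice; the sequence required by \<open>eh_volume\<close> is filled
    up with empty pieces.\<close>
  define K where "K = (\<lambda>n :: nat. if n \<le> 1 then U n \<inter> box else {})"
  have D: "D \<ge> 0"
    using r by (simp add: D_def add_nonneg_nonneg)
  have m: "m \<ge> 0"
    using \<open>G \<ge> 0\<close> pi_gt_zero by (simp add: m_def)
  have U: "eh_parametrization M par (U n)" for n
    unfolding U_def by (rule eh_parametrization_par) (simp add: M)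
  have "open (U n)" for n
    using U[of n] by (simp add: eh_parametrization_def eh_C1_on_def)
  then have K: "K n \<in> sets borel" "K n \<subseteq> U n" "K n \<subseteq> box" for n
    by (auto simp: K_def box_def)
  have cover: "B \<subseteq> (\<Union>n. par ` K n)"
  proof
    fix q assume q: "q \<in> B"
    have fib: "cmod (fib y) \<le> G" if "par y = q" for y
    proof -
      have "cmod (fib y) * 1 \<le> cmod (fib y) * (1 + r\<^sup>2)"
        by (intro mult_left_mono) auto
      also have "\<dots> = eh_u q"
        using that eh_u_par[of y] by simp
      also have "\<dots> \<le> G"
        using G[OF q] eh_S_ge(2)[OF t, of q] by linarith
      finally show ?thesis by simp
    qed
    have box: "y \<in> box" if "par y = q" "\<bar>y $ 1\<bar> \<le> 2 * pi" for y
    proof -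
      have "\<bar>Re (fib y)\<bar> \<le> m" "\<bar>Im (fib y)\<bar> \<le> m"
        unfolding m_def
        using abs_Re_le_cmod[of "fib y"] abs_Im_le_cmod[of "fib y"] fib[OF that(1)] pi_gt_zero by linarith+
      then have "\<bar>y $ 2\<bar> \<le> m" "\<bar>y $ 3\<bar> \<le> m"
        by (simp_all add: fib_def)
      moreover have "\<bar>y $ 1\<bar> \<le> m"
        using that(2) \<open>G \<ge> 0\<close> by (simp add: m_def)
      ultimately show ?thesis
        by (simp add: box_def mem_box_cart forall_3 abs_le_iff)
    qed
    obtain x where x: "q = par x"
      using q B M by blast
    show "q \<in> (\<Union>n. par ` K n)"
    proof (rule par_surj_strips[of x])
      fix y assume y: "par y = par x" "- pi < y $ 1" "y $ 1 < pi"
      then have "y \<in> K 0"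
        using box[of y] by (simp add: K_def U_def x)
      then show ?thesis
        unfolding x y(1)[symmetric] by (intro UN_I[of 0] imageI) auto
    next
      fix y assume y: "par y = par x" "0 < y $ 1" "y $ 1 < 2 * pi"
      then have "y \<in> K 1"
        using box[of y] by (simp add: K_def U_def x)
      then show ?thesis
        unfolding x y(1)[symmetric] by (intro UN_I[of 1] imageI) auto
    qed
  qed
  have box: "emeasure lborel box = ennreal ((2 * m) ^ 3)"
    unfolding box_def by (rule emeasure_centered_cube[OF m])
  have int: "(\<integral>\<^sup>+x\<in>K n. ennreal (eh_volume_density t par x) \<partial>lborel) \<le> ennreal (D * (2 * m) ^ 3)" for n
  proof -
    have "(\<integral>\<^sup>+x\<in>K n. ennreal (eh_volume_density t par x) \<partial>lborel) \<le> (\<integral>\<^sup>+x. ennreal D * indicator box x \<partial>lborel)"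
    proof (intro nn_integral_mono mult_mono)
      fix x
      have "eh_volume_density t par x \<le> D"
        unfolding eh_volume_density_par D_def using r t eh_S_ge(1)[OF t, of "par x"]
        by (intro divide_left_mono mult_pos_pos real_sqrt_le_mono mult_left_mono) (auto simp: add_nonneg_nonneg eh_S_pos)
      then show "ennreal (eh_volume_density t par x) \<le> ennreal D"
        by (rule ennreal_leI)
    qed (use K(3) in \<open>auto simp: indicator_def\<close>)
    also have "\<dots> = ennreal D * ennreal ((2 * m) ^ 3)"
      using box by (simp add: nn_integral_cmult_indicator box_def)
    also have "\<dots> = ennreal (D * (2 * m) ^ 3)"
      using D m by (simp add: ennreal_mult)
    finally show ?thesis .
  qed
  have "eh_volume t M B \<le> (\<Sum>n. \<integral>\<^sup>+x\<in>K n. ennreal (eh_volume_density t par x) \<partial>lborel)"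
    unfolding eh_volume_def using U K cover
    by (intro Inf_lower CollectI exI[of _ "\<lambda>_. par"] exI[of _ U] exI[of _ K]) auto
  also have "\<dots> = (\<Sum>n\<in>{0, 1}. \<integral>\<^sup>+x\<in>K n. ennreal (eh_volume_density t par x) \<partial>lborel)"
    by (rule suminf_finite) (auto simp: K_def)
  also have "\<dots> \<le> ennreal (D * (2 * m) ^ 3) + ennreal (D * (2 * m) ^ 3)"
    using int[of 0] int[of 1] by (simp add: add_mono)
  also have "\<dots> = ennreal (2 * D * (2 * m) ^ 3)"
    using D m by (simp flip: ennreal_plus)
  finally show ?thesis
    by (simp add: D_def m_def)
qed

end

section \<open>Lower volume bound\<close>

text \<open>The inverse of the unitary matrix \<open>(a, b; c, d)\<close>, followed by the affine chart.\<close>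

lift_definition eh_unrot :: "complex \<Rightarrow> complex \<Rightarrow> complex \<Rightarrow> complex \<Rightarrow> h2 \<Rightarrow> complex \<times> complex" is
  "\<lambda>a b c d (\<alpha>, \<beta>, \<gamma>). ((cnj a * \<alpha> + cnj c * \<beta>) / (cnj b * \<alpha> + cnj d * \<beta>), \<gamma> * (cnj b * \<alpha> + cnj d * \<beta>)\<^sup>2)"
proof -
  fix a b c d :: complex and p1 p2 :: "complex \<times> complex \<times> complex"
  assume "eh_rel p1 p2"
  then obtain A \<alpha> \<beta> \<gamma> where p: "p1 = (\<alpha>, \<beta>, \<gamma>)" "p2 = (A * \<alpha>, A * \<beta>, \<gamma> / A\<^sup>2)" "A \<noteq> 0"
    by (auto simp: eh_rel_def split: prod.splits)
  have "cnj a * (A * \<alpha>) + cnj c * (A * \<beta>) = A * (cnj a * \<alpha> + cnj c * \<beta>)"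
    "cnj b * (A * \<alpha>) + cnj d * (A * \<beta>) = A * (cnj b * \<alpha> + cnj d * \<beta>)"
    by algebra+
  then show "(case p1 of (\<alpha>, \<beta>, \<gamma>) \<Rightarrow> ((cnj a * \<alpha> + cnj c * \<beta>) / (cnj b * \<alpha> + cnj d * \<beta>), \<gamma> * (cnj b * \<alpha> + cnj d * \<beta>)\<^sup>2))
    = (case p2 of (\<alpha>, \<beta>, \<gamma>) \<Rightarrow> ((cnj a * \<alpha> + cnj c * \<beta>) / (cnj b * \<alpha> + cnj d * \<beta>), \<gamma> * (cnj b * \<alpha> + cnj d * \<beta>)\<^sup>2))"
    using p(3) unfolding p by (simp add: power_mult_distrib)
qed

lemma eh_unrot_abs:
  assumes "\<alpha> \<noteq> 0 \<or> \<beta> \<noteq> 0"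
  shows "eh_unrot a b c d (abs_h2 (\<alpha>, \<beta>, \<gamma>)) =
    ((cnj a * \<alpha> + cnj c * \<beta>) / (cnj b * \<alpha> + cnj d * \<beta>), \<gamma> * (cnj b * \<alpha> + cnj d * \<beta>)\<^sup>2)"
  using assms by (simp add: eh_unrot.abs_eq eh_rel_refl_iff)

lemma eh_point_chart:
  assumes "q \<in> eh_dom k"
  shows "eh_point k (eh_chart k q) = q"
proof -
  obtain \<alpha> \<beta> \<gamma> where q: "q = abs_h2 (\<alpha>, \<beta>, \<gamma>)" "\<alpha> \<noteq> 0 \<or> \<beta> \<noteq> 0"
    by (rule h2_cases)
  show ?thesis
  proof (cases k)
    case Aff
    then have "\<beta> \<noteq> 0"
      using assms eh_dom_abs(1)[OF q(2)] q(1) by simp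
    then show ?thesis
      unfolding Aff q(1) eh_chart_abs(1)[OF q(2)] eh_point.simps vector_2
      by (subst abs_h2_eq_iff) (auto simp: eh_rel_def intro!: exI[of _ \<beta>])
  next
    case AtInf
    then have "\<alpha> \<noteq> 0"
      using assms eh_dom_abs(2)[OF q(2)] q(1) by simp
    then show ?thesis
      unfolding AtInf q(1) eh_chart_abs(2)[OF q(2)] eh_point.simps vector_2
      by (subst abs_h2_eq_iff) (auto simp: eh_rel_def intro!: exI[of _ \<alpha>])
  qed
qed

lemma differentiable_bounded_linear:
  assumes "bounded_linear f" "g differentiable F"
  shows "(\<lambda>x. f (g x)) differentiable F"
  using assms bounded_linear.has_derivative unfolding differentiable_def by blast

text \<open>The change of variables formula for nonnegative integrals: if the integral is finite,
  the Jacobian is integrable and equality holds; if not, there is nothing to show.\<close>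

lemma emeasure_differentiable_image_le:
  fixes f :: "real ^ 'n::{finite, wellorder} \<Rightarrow> real ^ 'n::_"
  assumes S: "S \<in> sets lebesgue" and der: "\<And>x. x \<in> S \<Longrightarrow> (f has_derivative f' x) (at x)" and inj: "inj_on f S"
  shows "f ` S \<in> sets lebesgue"
    and "emeasure lebesgue (f ` S) \<le> (\<integral>\<^sup>+x\<in>S. ennreal \<bar>det (matrix (f' x))\<bar> \<partial>lborel)"
proof -
  have der': "(f has_derivative f' x) (at x within S)" if "x \<in> S" for x
    using der[OF that] by (rule has_derivative_at_withinI)
  then show "f ` S \<in> sets lebesgue"
    by (intro differentiable_image_in_sets_lebesgue[OF S]) (auto simp: differentiable_on_def differentiable_def)
  have eq: "(\<integral>\<^sup>+x\<in>S. ennreal \<bar>det (matrix (f' x))\<bar> \<partial>lborel) = (\<integral>\<^sup>+x. ennreal (norm \<bar>det (matrix (f' x))\<bar>) \<partial>lebesgue_on S)"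
    using S by (simp add: nn_integral_restrict_space nn_integral_completion)
  show "emeasure lebesgue (f ` S) \<le> (\<integral>\<^sup>+x\<in>S. ennreal \<bar>det (matrix (f' x))\<bar> \<partial>lborel)"
  proof (cases "(\<integral>\<^sup>+x\<in>S. ennreal \<bar>det (matrix (f' x))\<bar> \<partial>lborel) = \<infinity>")
    case False
    have "(\<lambda>x. det (matrix (f' x))) \<in> borel_measurable (lebesgue_on S)"
      by (rule borel_measurable_det_Jacobian[OF S der'])
    then have int: "integrable (lebesgue_on S) (\<lambda>x. \<bar>det (matrix (f' x))\<bar>)"
      unfolding integrable_iff_bounded using False eq by (simp add: top.not_eq_extremum)
    then have HK: "((\<lambda>x. \<bar>det (matrix (f' x))\<bar>) has_integral integral\<^sup>L (lebesgue_on S) (\<lambda>x. \<bar>det (matrix (f' x))\<bar>)) S"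
      by (rule has_integral_integral_lebesgue_on[OF _ S])
    have "f ` S \<in> lmeasurable \<and> measure lebesgue (f ` S) = integral\<^sup>L (lebesgue_on S) (\<lambda>x. \<bar>det (matrix (f' x))\<bar>)"
      using has_measure_differentiable_image[OF S der' inj] HK by blast
    then have "emeasure lebesgue (f ` S) = ennreal (integral\<^sup>L (lebesgue_on S) (\<lambda>x. \<bar>det (matrix (f' x))\<bar>))"
      by (simp add: emeasure_eq_measure2)
    also have "\<dots> = (\<integral>\<^sup>+x. ennreal \<bar>det (matrix (f' x))\<bar> \<partial>lebesgue_on S)"
      using nn_integral_eq_integral[OF int] by simp
    finally show ?thesis
      using eq by simp
  qed simp
qed

section \<open>The inverse of the parametrisation off a branch cut, and comparison of
  volumes\<close>

context eh_circle
begin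

text \<open>The domain where \<open>Ln\<close> of the rotated affine coordinate is differentiable.
  Division by zero gives 0, so the point at infinity is excluded as well.\<close>

definition slit :: "h2 set" where
  "slit = {q. fst (eh_unrot a b c d q) \<notin> \<real>\<^sub>\<le>\<^sub>0}"

text \<open>Defined on all of H^2 and not just on the submanifold, so that its composition with a
  map into H^2 can be differentiated in the charts of H^2.\<close>

definition unpar :: "h2 \<Rightarrow> real ^ 3" where
  "unpar q = Im (Ln (fst (eh_unrot a b c d q))) *\<^sub>R axis 1 1 + Re (snd (eh_unrot a b c d q)) *\<^sub>R axis 2 1
     + Im (snd (eh_unrot a b c d q)) *\<^sub>R axis 3 1"

lemma unpar_nth: "unpar q $ 1 = Im (Ln (fst (eh_unrot a b c d q)))"
  "unpar q $ 2 = Re (snd (eh_unrot a b c d q))" "unpar q $ 3 = Im (snd (eh_unrot a b c d q))"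
  by (simp_all add: unpar_def axis_def)

lemma eh_unrot_par: "eh_unrot a b c d (par x) = (circ x, fib x)"
proof -
  have "cnj a * (a * circ x + b) + cnj c * (c * circ x + d) = circ x"
    using col by algebra
  moreover have "cnj b * (a * circ x + b) + cnj d * (c * circ x + d) = 1"
    using col col_conj by algebra
  ultimately show ?thesis
    unfolding par_def eh_unrot_abs[OF par_nz] by simp
qed

text \<open>Valid on the cut too, since any choice of argument has the right exponential. This makes
  \<open>unpar\<close> injective on the submanifold.\<close>

lemma par_unpar:
  assumes "q \<in> range par"
  shows "par (unpar q) = q"
proof -
  obtain x where q: "q = par x"
    using assms by blast
  have "circ x \<noteq> 0"
    using cmod_circ[of x] r by auto
  have "unpar q $ 1 = Arg (circ x)"
    unfolding unpar_nth q eh_unrot_par fst_conv using \<open>circ x \<noteq> 0\<close> by (simp add: Arg_eq_Im_Ln)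
  then have "circ (unpar q) = rcis (cmod (circ x)) (Arg (circ x))"
    unfolding circ_def[of "unpar q"] cmod_circ by (simp add: rcis_def cis_conv_exp)
  moreover have "fib (unpar q) = fib x"
    unfolding fib_eq_iff unpar_nth q eh_unrot_par snd_conv by (simp add: fib_def)
  ultimately show ?thesis
    unfolding q by (simp add: par_eq_iff rcis_cmod_Arg)
qed

lemma unpar_par:
  assumes "\<bar>x $ 1\<bar> < pi"
  shows "unpar (par x) = x" "par x \<in> slit"
proof -
  have e: "circ x = exp (Complex (ln r) (x $ 1))"
    using r by (simp add: circ_def Complex_eq exp_add exp_of_real)
  have Ln: "Ln (circ x) = Complex (ln r) (x $ 1)"
    unfolding e by (rule Ln_exp) (use assms in auto)
  show "unpar (par x) = x"
    unfolding vec_eq_iff forall_3 unpar_nth eh_unrot_par fst_conv snd_conv Ln by (simp add: fib_def)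
  have "circ x \<noteq> 0"
    unfolding e by simp
  show "par x \<in> slit"
  proof (rule ccontr)
    assume "par x \<notin> slit"
    then have "circ x \<in> \<real>\<^sub>\<le>\<^sub>0"
      by (simp add: slit_def eh_unrot_par)
    then have "Im (Ln (circ x)) = pi"
      using \<open>circ x \<noteq> 0\<close> by (auto simp: Im_Ln_eq_pi complex_nonpos_Reals_iff complex_eq_iff)
    then show False
      using assms unfolding Ln by simp
  qed
qed

lemma open_slit: "open slit"
proof -
  define \<alpha> where "\<alpha> = (\<lambda>x :: complex \<times> complex \<times> complex. cnj a * fst x + cnj c * fst (snd x))"
  define \<beta> where "\<beta> = (\<lambda>x :: complex \<times> complex \<times> complex. cnj b * fst x + cnj d * fst (snd x))"
  have "open ({x. eh_rel x x} \<inter> {x. \<beta> x \<noteq> 0})"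
    unfolding \<beta>_def by (intro open_Int open_valid open_Collect_neq continuous_intros)
  moreover have "continuous_on ({x. eh_rel x x} \<inter> {x. \<beta> x \<noteq> 0}) (\<lambda>x. \<alpha> x / \<beta> x)"
    unfolding \<alpha>_def \<beta>_def by (intro continuous_intros) auto
  ultimately have "open (({x. eh_rel x x} \<inter> {x. \<beta> x \<noteq> 0}) \<inter> (\<lambda>x. \<alpha> x / \<beta> x) -` (- \<real>\<^sub>\<le>\<^sub>0))"
    by (intro continuous_open_preimage) (auto simp: open_Compl)
  also have "({x. eh_rel x x} \<inter> {x. \<beta> x \<noteq> 0}) \<inter> (\<lambda>x. \<alpha> x / \<beta> x) -` (- \<real>\<^sub>\<le>\<^sub>0) = {x. eh_rel x x \<and> abs_h2 x \<in> slit}"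
    by (auto simp: slit_def \<alpha>_def \<beta>_def eh_rel_refl_iff eh_unrot_abs)
  finally show ?thesis
    by (simp add: open_h2_def)
qed

lemma unpar_compose_differentiable:
  assumes C1: "eh_C1_on \<phi> W" and x: "x \<in> W" and slit: "\<phi> x \<in> slit"
  shows "(\<lambda>y. unpar (\<phi> y)) differentiable (at x)"
proof -
  define k where "k = eh_index_at (\<phi> x)"
  have k: "\<phi> x \<in> eh_dom k"
    unfolding k_def by (rule eh_index_at_dom)
  define p where "p = eh_chart k \<circ> \<phi>"
  have p: "p differentiable (at x)"
    unfolding p_def using eh_chart_has_derivative[OF C1 x k] by (auto simp: differentiable_def)
  \<comment> \<open>Homogeneous coordinates with one of the first two normalised to 1;
    \<open>eh_unrot\<close> is rational in them.\<close>
  define \<alpha> where "\<alpha> = (\<lambda>y. case k of Aff \<Rightarrow> p y $ 1 | AtInf \<Rightarrow> 1)"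
  define \<beta> where "\<beta> = (\<lambda>y. case k of Aff \<Rightarrow> 1 | AtInf \<Rightarrow> p y $ 1)"
  define \<gamma> where "\<gamma> = (\<lambda>y. p y $ 2)"
  have nz: "\<alpha> y \<noteq> 0 \<or> \<beta> y \<noteq> 0" for y
    by (cases k) (simp_all add: \<alpha>_def \<beta>_def)
  have abc: "\<alpha> differentiable (at x)" "\<beta> differentiable (at x)" "\<gamma> differentiable (at x)"
    using differentiable_bounded_linear[OF bounded_linear_vec_nth p]
    by (cases k; simp add: \<alpha>_def \<beta>_def \<gamma>_def)+
  have rep: "abs_h2 (\<alpha> y, \<beta> y, \<gamma> y) = \<phi> y" if "\<phi> y \<in> eh_dom k" for y
    using eh_point_chart[OF that] by (cases k) (simp_all add: \<alpha>_def \<beta>_def \<gamma>_def p_def)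
  define A where "A = (\<lambda>y. cnj a * \<alpha> y + cnj c * \<beta> y)"
  define B where "B = (\<lambda>y. cnj b * \<alpha> y + cnj d * \<beta> y)"
  have AB: "A differentiable (at x)" "B differentiable (at x)"
    unfolding A_def B_def by (intro differentiable_add differentiable_mult differentiable_const abc)+
  have unrot: "eh_unrot a b c d (\<phi> y) = (A y / B y, \<gamma> y * (B y)\<^sup>2)" if "\<phi> y \<in> eh_dom k" for y
    unfolding rep[OF that, symmetric] eh_unrot_abs[OF nz] A_def B_def ..
  have slit': "A x / B x \<notin> \<real>\<^sub>\<le>\<^sub>0"
    using slit unrot[OF k] by (simp add: slit_def)
  then have "B x \<noteq> 0"
    by auto
  then have "(\<lambda>y. A y / B y) differentiable (at x)"
    by (intro differentiable_divide AB)
  then obtain E where "((\<lambda>y. A y / B y) has_derivative E) (at x)"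
    unfolding differentiable_def by blast
  from has_derivative_compose[OF this has_field_derivative_Ln[OF slit', THEN has_field_derivative_imp_has_derivative]]
  have Ln: "(\<lambda>y. Ln (A y / B y)) differentiable (at x)"
    by (rule differentiableI)
  have c: "(\<lambda>y. \<gamma> y * (B y)\<^sup>2) differentiable (at x)"
    by (intro differentiable_mult differentiable_power abc AB)
  have "(\<lambda>y. Im (Ln (A y / B y)) *\<^sub>R axis 1 1 + Re (\<gamma> y * (B y)\<^sup>2) *\<^sub>R axis 2 1 + Im (\<gamma> y * (B y)\<^sup>2) *\<^sub>R axis 3 1 :: real ^ 3) differentiable (at x)"
    by (intro differentiable_add differentiable_scaleR differentiable_const
        differentiable_bounded_linear[OF bounded_linear_Im] differentiable_bounded_linear[OF bounded_linear_Re] Ln c)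
  then obtain D where D: "((\<lambda>y. Im (Ln (A y / B y)) *\<^sub>R axis 1 1 + Re (\<gamma> y * (B y)\<^sup>2) *\<^sub>R axis 2 1 + Im (\<gamma> y * (B y)\<^sup>2) *\<^sub>R axis 3 1 :: real ^ 3) has_derivative D) (at x)"
    unfolding differentiable_def by blast
  have ev: "\<forall>\<^sub>F y in nhds x. Im (Ln (A y / B y)) *\<^sub>R axis 1 1 + Re (\<gamma> y * (B y)\<^sup>2) *\<^sub>R axis 2 1 + Im (\<gamma> y * (B y)\<^sup>2) *\<^sub>R axis 3 1 = unpar (\<phi> y)"
    using eventually_eh_dom[OF C1 x k] by eventually_elim (simp add: unpar_def unrot del: eh_dom.simps)
  from ev have ev': "\<forall>\<^sub>F y in at x. Im (Ln (A y / B y)) *\<^sub>R axis 1 1 + Re (\<gamma> y * (B y)\<^sup>2) *\<^sub>R axis 2 1 + Im (\<gamma> y * (B y)\<^sup>2) *\<^sub>R axis 3 1 = unpar (\<phi> y)"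
    unfolding eventually_nhds_conv_at by (rule conjunct1)
  have "((\<lambda>y. unpar (\<phi> y)) has_derivative D) (at x)"
    by (rule has_derivative_transform_eventually[OF D ev' eventually_nhds_x_imp_x[OF ev] UNIV_I])
  then show ?thesis
    unfolding differentiable_def by blast
qed

text \<open>Near \<open>x\<close> the map \<phi> equals \<open>par\<close> after
  \<open>unpar\<close> after \<phi>, so the formula for compositions with \<open>par\<close>
  applies.\<close>

lemma eh_pullback_unpar:
  assumes C1: "eh_C1_on \<phi> W" and x: "x \<in> W" and slit: "\<phi> x \<in> slit" and range: "\<phi> ` W \<subseteq> range par"
  shows "eh_pullback t \<phi> x v w = par_form (unpar (\<phi> x))
    (frechet_derivative (\<lambda>y. unpar (\<phi> y)) (at x) v) (frechet_derivative (\<lambda>y. unpar (\<phi> y)) (at x) w)"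
proof -
  define D where "D = frechet_derivative (\<lambda>y. unpar (\<phi> y)) (at x)"
  have D: "((\<lambda>y. unpar (\<phi> y)) has_derivative D) (at x)"
    using unpar_compose_differentiable[OF C1 x slit] unfolding D_def frechet_derivative_works .
  define k where "k = eh_index_at (\<phi> x)"
  have k: "\<phi> x \<in> eh_dom k"
    unfolding k_def by (rule eh_index_at_dom)
  have eq: "par (unpar (\<phi> y)) = \<phi> y" if "y \<in> W" for y
    using range that by (intro par_unpar) auto
  have "\<forall>\<^sub>F y in nhds x. y \<in> W"
    using C1 x by (auto simp: eh_C1_on_def eventually_nhds)
  then have "\<forall>\<^sub>F y in at x. y \<in> W"
    unfolding eventually_nhds_conv_at by (rule conjunct1)
  then have ev: "\<forall>\<^sub>F y in at x. (eh_chart k \<circ> \<phi>) y = (eh_chart k \<circ> (\<lambda>y. par (unpar (\<phi> y)))) y"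
    by eventually_elim (simp add: eq)
  have "(eh_chart k \<circ> \<phi> has_derivative eh_deriv \<phi> x) (at x)"
    unfolding eh_deriv_def k_def[symmetric] by (rule eh_chart_has_derivative[OF C1 x k])
  from has_derivative_transform_eventually[OF this ev _ UNIV_I]
  have "(eh_chart k \<circ> (\<lambda>y. par (unpar (\<phi> y))) has_derivative eh_deriv \<phi> x) (at x)"
    by (simp add: eq[OF x] comp_def)
  then have "eh_deriv (\<lambda>y. par (unpar (\<phi> y))) x = eh_deriv \<phi> x"
    unfolding eh_deriv_def[of "\<lambda>y. par (unpar (\<phi> y))"] eq[OF x] k_def by (metis frechet_derivative_at)
  then have "eh_pullback t \<phi> x v w = eh_pullback t (\<lambda>y. par (unpar (\<phi> y))) x v w"
    unfolding eh_pullback_def by (simp add: eq[OF x])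
  also have "\<dots> = par_form (unpar (\<phi> x)) (D v) (D w)"
    by (rule eh_pullback_par_compose[OF D])
  finally show ?thesis
    unfolding D_def .
qed

lemma par_form_expand:
  "par_form y v w = (\<Sum>k\<in>UNIV. \<Sum>l\<in>UNIV. v $ k * par_form y (axis k 1) (axis l 1) * w $ l)"
proof -
  have Q: "par_Q y v = (v $ 1) *\<^sub>R par_Q y (axis 1 1) + (v $ 2) *\<^sub>R par_Q y (axis 2 1) + (v $ 3) *\<^sub>R par_Q y (axis 3 1)" for v
    by (simp add: par_Q_def fib_def axis_def scaleR_conv_of_real algebra_simps)
  have ax: "axis 1 1 $ (1 :: 3) = (1 :: real)" "axis 2 1 $ (1 :: 3) = (0 :: real)" "axis 3 1 $ (1 :: 3) = (0 :: real)"
    by (simp_all add: axis_def)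
  define S where "S = eh_S t (par y)"
  define q1 q2 q3 where "q1 = par_Q y (axis 1 1)" and "q2 = par_Q y (axis 2 1)" and "q3 = par_Q y (axis 3 1)"
  show ?thesis
    unfolding par_form_def sum_3 ax Q[of v] Q[of w]
    unfolding S_def[symmetric] q1_def[symmetric] q2_def[symmetric] q3_def[symmetric]
    by (simp add: inner_add_left inner_add_right algebra_simps)
qed

text \<open>The Gram matrix changes by congruence with the Jacobian matrix, its determinant by the
  squared Jacobian.\<close>

lemma eh_volume_density_unpar:
  assumes C1: "eh_C1_on \<phi> W" and x: "x \<in> W" and slit: "\<phi> x \<in> slit" and range: "\<phi> ` W \<subseteq> range par"
  shows "eh_volume_density t \<phi> x = \<bar>det (matrix (frechet_derivative (\<lambda>y. unpar (\<phi> y)) (at x)))\<bar>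
    * eh_volume_density t par (unpar (\<phi> x))"
proof -
  define D where "D = frechet_derivative (\<lambda>y. unpar (\<phi> y)) (at x)"
  define y where "y = unpar (\<phi> x)"
  define G :: "real ^ 3 ^ 3" where "G = (\<chi> i j. par_form y (axis i 1) (axis j 1))"
  have "(\<chi> i j. par_form y (D (axis i 1)) (D (axis j 1))) = transpose (matrix D) ** G ** matrix D"
    unfolding vec_eq_iff matrix_matrix_mult_def transpose_def matrix_def G_def vec_lambda_beta
    unfolding par_form_expand[of y "D _"] sum_3 by (simp add: algebra_simps)
  then have "det (\<chi> i j. par_form y (D (axis i 1)) (D (axis j 1))) = (det (matrix D))\<^sup>2 * det G"
    by (simp add: det_mul det_transpose power2_eq_square)
  then show ?thesis
    unfolding eh_volume_density_def eh_pullback_unpar[OF assms] eh_pullback_par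
    by (simp add: D_def y_def G_def real_sqrt_mult)
qed

text \<open>Every piece of a covering is carried by \<open>unpar\<close> to the parameter space. The
  images there cover V, countable subadditivity bounds the measure of V by integrals of Jacobians,
  and the density relation turns these into the volumes of the pieces.\<close>

lemma eh_volume_lower:
  assumes M: "M = range par" and V: "V \<in> sets borel" "\<And>x. x \<in> V \<Longrightarrow> \<bar>x $ 1\<bar> < pi" "par ` V \<subseteq> B"
    and e: "e > 0" "\<And>x. x \<in> V \<Longrightarrow> e \<le> eh_volume_density t par x"
  shows "ennreal e * emeasure lborel V \<le> eh_volume t M B"
  unfolding eh_volume_def
proof (rule Inf_greatest, safe)
  fix \<phi> :: "nat \<Rightarrow> real ^ 3 \<Rightarrow> h2" and U K :: "nat \<Rightarrow> (real ^ 3) set"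
  assume n: "\<forall>n. eh_parametrization M (\<phi> n) (U n) \<and> K n \<in> sets borel \<and> K n \<subseteq> U n"
    and B: "B \<subseteq> (\<Union>n. \<phi> n ` K n)"
  have C1: "eh_C1_on (\<phi> n) (U n)" and range: "\<phi> n ` U n \<subseteq> range par" and inj: "inj_on (\<phi> n) (U n)"
    and K: "K n \<in> sets borel" "K n \<subseteq> U n" for n
    using n M by (auto simp: eh_parametrization_def)
  define \<psi> where "\<psi> = (\<lambda>n y. unpar (\<phi> n y))"
  define D where "D = (\<lambda>n x. frechet_derivative (\<psi> n) (at x))"
  define W where "W = (\<lambda>n. U n \<inter> \<phi> n -` slit)"
  \<comment> \<open>The part of the n-th piece that lies off the cut and lands in V;
    \<open>unpar\<close> is differentiable along it.\<close>
  define L where "L = (\<lambda>n. K n \<inter> (W n \<inter> \<psi> n -` V))"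
  have der: "(\<psi> n has_derivative D n x) (at x)" if "x \<in> W n" for n x
    using unpar_compose_differentiable[OF C1[of n], of x] that
    unfolding D_def frechet_derivative_works[symmetric] W_def \<psi>_def by auto
  have W: "open (W n)" for n
    unfolding W_def using C1[of n] open_slit by (auto simp: eh_C1_on_def intro!: continuous_open_preimage)
  have "continuous_on (W n) (\<psi> n)" for n
    using der by (meson continuous_at_imp_continuous_on has_derivative_continuous)
  then have meas: "\<psi> n \<in> borel_measurable (restrict_space borel (W n))" for n
    by (rule borel_measurable_continuous_on_restrict)
  have "\<psi> n -` V \<inter> W n \<in> sets borel" for n
    using measurable_sets[OF meas V(1), of n] borel_open[OF W[of n]]
    by (simp add: sets_restrict_space_iff space_restrict_space)
  then have L: "L n \<in> sets borel" for n
    unfolding L_def using K(1)[of n] by (auto simp: Int_commute)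
  have inj: "inj_on (\<psi> n) (L n)" for n
  proof (rule inj_onI)
    fix x y assume "x \<in> L n" "y \<in> L n" "\<psi> n x = \<psi> n y"
    then have xy: "x \<in> U n" "y \<in> U n" and "unpar (\<phi> n x) = unpar (\<phi> n y)"
      by (auto simp: L_def W_def \<psi>_def)
    moreover have "\<phi> n x \<in> range par" "\<phi> n y \<in> range par"
      using xy range by auto
    ultimately have "\<phi> n x = \<phi> n y"
      using par_unpar by metis
    then show "x = y"
      using inj xy by (meson inj_onD)
  qed
  have L': "L n \<in> sets lebesgue" for n
    using L by simp
  have derL: "(\<psi> n has_derivative D n x) (at x)" if "x \<in> L n" for n x
    using that by (intro der) (auto simp: L_def)
  note im = emeasure_differentiable_image_le[OF L' derL inj]
  have "V \<subseteq> (\<Union>n. \<psi> n ` L n)"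
  proof
    fix p assume p: "p \<in> V"
    then have "par p \<in> B"
      using V(3) by blast
    then obtain n x where x: "x \<in> K n" "par p = \<phi> n x"
      using B by blast
    have "\<psi> n x = p" "\<phi> n x \<in> slit"
      using unpar_par[OF V(2)[OF p]] x(2) by (simp_all add: \<psi>_def)
    then have "x \<in> L n" "p = \<psi> n x"
      using x p K(2) by (auto simp: L_def W_def)
    then show "p \<in> (\<Union>n. \<psi> n ` L n)"
      by blast
  qed
  then have "emeasure lebesgue V \<le> emeasure lebesgue (\<Union>n. \<psi> n ` L n)"
    using im(1) by (intro emeasure_mono sets.countable_UN) auto
  also have "\<dots> \<le> (\<Sum>n. emeasure lebesgue (\<psi> n ` L n))"
    using im(1) by (intro emeasure_subadditive_countably) auto
  finally have "ennreal e * emeasure lebesgue V \<le> ennreal e * (\<Sum>n. emeasure lebesgue (\<psi> n ` L n))"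
    by (rule mult_left_mono) simp
  also have "\<dots> = (\<Sum>n. ennreal e * emeasure lebesgue (\<psi> n ` L n))"
    by simp
  also have "\<dots> \<le> (\<Sum>n. \<integral>\<^sup>+x\<in>K n. ennreal (eh_volume_density t (\<phi> n) x) \<partial>lborel)"
  proof (intro suminf_le summableI)
    fix n
    have "ennreal e * emeasure lebesgue (\<psi> n ` L n) \<le> ennreal e * (\<integral>\<^sup>+x\<in>L n. ennreal \<bar>det (matrix (D n x))\<bar> \<partial>lborel)"
      by (rule mult_left_mono[OF im(2)]) simp_all
    \<comment> \<open>The Jacobian is known to be Lebesgue measurable, so the constant is moved
      under the integral over \<open>lebesgue\<close>.\<close>
    also have "\<dots> = ennreal e * (\<integral>\<^sup>+x\<in>L n. ennreal \<bar>det (matrix (D n x))\<bar> \<partial>lebesgue)"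
      by (simp add: nn_integral_completion)
    also have "\<dots> = (\<integral>\<^sup>+x. ennreal e * (ennreal \<bar>det (matrix (D n x))\<bar> * indicator (L n) x) \<partial>lebesgue)"
    proof (rule nn_integral_cmult[symmetric])
      have "(\<lambda>x. det (matrix (D n x))) \<in> borel_measurable (lebesgue_on (L n))"
        by (rule borel_measurable_det_Jacobian[OF L' has_derivative_at_withinI[OF derL]])
      then have "(\<lambda>x. ennreal \<bar>det (matrix (D n x))\<bar>) \<in> borel_measurable (lebesgue_on (L n))"
        by measurable
      then show "(\<lambda>x. ennreal \<bar>det (matrix (D n x))\<bar> * indicator (L n) x) \<in> borel_measurable lebesgue"
        by (rule borel_measurable_restrict_space_iff_ennreal[THEN iffD1, rotated]) (use L'[of n] in simp)
    qed
    also have "\<dots> = (\<integral>\<^sup>+x. ennreal e * (ennreal \<bar>det (matrix (D n x))\<bar> * indicator (L n) x) \<partial>lborel)"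
      by (simp add: nn_integral_completion)
    also have "\<dots> \<le> (\<integral>\<^sup>+x\<in>K n. ennreal (eh_volume_density t (\<phi> n) x) \<partial>lborel)"
    proof (rule nn_integral_mono)
      fix x
      show "ennreal e * (ennreal \<bar>det (matrix (D n x))\<bar> * indicator (L n) x) \<le> ennreal (eh_volume_density t (\<phi> n) x) * indicator (K n) x"
      proof (cases "x \<in> L n")
        case True
        then have x: "x \<in> U n" "\<phi> n x \<in> slit" "\<psi> n x \<in> V" "x \<in> K n"
          by (auto simp: L_def W_def)
        have "e * \<bar>det (matrix (D n x))\<bar> \<le> eh_volume_density t par (\<psi> n x) * \<bar>det (matrix (D n x))\<bar>"
          by (intro mult_right_mono e(2) x(3)) simp
        also have "\<dots> = eh_volume_density t (\<phi> n) x"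
          unfolding eh_volume_density_unpar[OF C1 x(1,2) range] D_def \<psi>_def by simp
        finally show ?thesis
          using True x(4) e(1) by (simp add: ennreal_leI flip: ennreal_mult)
      qed simp
    qed
    finally show "ennreal e * emeasure lebesgue (\<psi> n ` L n) \<le> (\<integral>\<^sup>+x\<in>K n. ennreal (eh_volume_density t (\<phi> n) x) \<partial>lborel)" .
  qed
  finally show "ennreal e * emeasure lborel V \<le> (\<Sum>n. \<integral>\<^sup>+x\<in>K n. ennreal (eh_volume_density t (\<phi> n) x) \<partial>lborel)"
    using V(1) by simp
qed

end

section \<open>Exponential growth\<close>

lemma ext_ln_ennreal: "x > 0 \<Longrightarrow> ext_ln (ennreal x) = ereal (ln x)"
  by (simp add: ext_ln_def)

lemma ext_ln_mono: "v \<le> w \<Longrightarrow> ext_ln v \<le> ext_ln w"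
proof -
  assume "v \<le> w"
  consider "v = 0" | "w = top" | "v \<noteq> 0" "w \<noteq> top" by blast
  then show ?thesis
  proof cases
    case 3
    then have "v \<noteq> top" "w \<noteq> 0"
      using \<open>v \<le> w\<close> by (auto simp: top_unique)
    moreover have "enn2real v \<le> enn2real w" "0 < enn2real v"
      using \<open>v \<le> w\<close> 3 \<open>v \<noteq> top\<close> by (auto simp: enn2real_mono enn2real_positive_iff top.not_eq_extremum zero_less_iff_neq_zero)
    ultimately show ?thesis
      using 3 by (simp add: ext_ln_def)
  qed (auto simp: ext_ln_def)
qed

text \<open>Squeezed between ln c / R, with c the lower bound, and (ln C + m ln (1 + R)) / R, both
  of which tend to 0.\<close>

lemma growth_zero:
  assumes c: "c\<^sub>0 > 0" "C > 0"
    and lower: "\<forall>\<^sub>F R in at_top. ennreal c\<^sub>0 \<le> v R"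
    and upper: "\<forall>\<^sub>F R in at_top. v R \<le> ennreal (C * (1 + R) ^ m)"
  shows "Limsup at_top (\<lambda>R :: real. ext_ln (v R) / ereal R) = 0"
proof (rule lim_imp_Limsup)
  have "((\<lambda>R. ln c\<^sub>0 / R) \<longlongrightarrow> 0) at_top"
    by real_asymp
  then have 1: "((\<lambda>R. ereal (ln c\<^sub>0 / R)) \<longlongrightarrow> 0) at_top"
    by (simp add: zero_ereal_def)
  have "((\<lambda>R. ln C / R + real m * (ln (1 + R) / R)) \<longlongrightarrow> 0 + real m * 0) at_top"
    by (intro tendsto_intros; real_asymp)
  then have 2: "((\<lambda>R. ereal (ln C / R + real m * (ln (1 + R) / R))) \<longlongrightarrow> 0) at_top"
    by (simp add: zero_ereal_def)
  show "((\<lambda>R. ext_ln (v R) / ereal R) \<longlongrightarrow> 0) at_top"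
  proof (rule tendsto_sandwich[OF _ _ 1 2])
    show "\<forall>\<^sub>F R in at_top. ereal (ln c\<^sub>0 / R) \<le> ext_ln (v R) / ereal R"
      using lower eventually_gt_at_top[of 0]
    proof eventually_elim
      fix R :: real assume R: "ennreal c\<^sub>0 \<le> v R" "0 < R"
      have "ereal (ln c\<^sub>0) / ereal R \<le> ext_ln (v R) / ereal R"
        using ext_ln_mono[OF R(1)] R(2) c by (intro ereal_divide_right_mono) (auto simp: ext_ln_ennreal)
      then show "ereal (ln c\<^sub>0 / R) \<le> ext_ln (v R) / ereal R"
        using R(2) by simp
    qed
    show "\<forall>\<^sub>F R in at_top. ext_ln (v R) / ereal R \<le> ereal (ln C / R + real m * (ln (1 + R) / R))"
      using upper eventually_gt_at_top[of 0]
    proof eventually_elim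
      fix R :: real assume R: "v R \<le> ennreal (C * (1 + R) ^ m)" "0 < R"
      have "ext_ln (v R) / ereal R \<le> ereal (ln (C * (1 + R) ^ m)) / ereal R"
        using ext_ln_mono[OF R(1)] R(2) c by (intro ereal_divide_right_mono) (auto simp: ext_ln_ennreal)
      also have "\<dots> = ereal (ln C / R + real m * (ln (1 + R) / R))"
        using R(2) c by (simp add: ln_mult ln_realpow add_divide_distrib)
      finally show "ext_ln (v R) / ereal R \<le> ereal (ln C / R + real m * (ln (1 + R) / R))" .
    qed
  qed
qed simp

context eh_circle
begin

lemma eh_volume_ball_lower:
  obtains c\<^sub>0 R\<^sub>0 where "c\<^sub>0 > 0" "\<And>R. R \<ge> R\<^sub>0 \<Longrightarrow> ennreal c\<^sub>0 \<le> eh_volume t (range par) (eh_ball t (range par) (par x\<^sub>0) R)"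
proof -
  \<comment> \<open>Angles in [-1, 1] stay inside (-pi, pi), away from the branch cut.\<close>
  define V :: "(real ^ 3) set" where "V = cbox (\<chi> i. - 1) (\<chi> i. 1)"
  have "V \<noteq> {}"
    by (simp add: V_def interval_ne_empty_cart)
  have V: "emeasure lborel V = ennreal 8"
    using emeasure_centered_cube[of 1] by (simp add: V_def)
  have "compact V"
    by (simp add: V_def compact_cbox)
  moreover have "continuous_on V (\<lambda>x. eh_S t (par x))"
    by (intro continuous_on_eh_S_par continuous_on_id)
  ultimately obtain z where z: "\<And>x. x \<in> V \<Longrightarrow> eh_S t (par x) \<le> eh_S t (par z)"
    using continuous_attains_sup[of V "\<lambda>x. eh_S t (par x)"] \<open>V \<noteq> {}\<close> by blast
  define e where "e = r * (1 + r\<^sup>2) / sqrt (2 * eh_S t (par z))"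
  have "e > 0"
    using r one_plus_r2 eh_S_pos[OF t, of "par z"] by (simp add: e_def)
  have dens: "e \<le> eh_volume_density t par x" if "x \<in> V" for x
    unfolding eh_volume_density_par e_def using z[OF that] r one_plus_r2 eh_S_pos[OF t, of "par x"]
    by (intro divide_left_mono real_sqrt_le_mono mult_left_mono mult_pos_pos) auto
  \<comment> \<open>A single parameter ball containing the base point and V bounds all distances
    between them.\<close>
  have "bounded (insert x\<^sub>0 V)"
    using \<open>compact V\<close> by (simp add: compact_imp_bounded)
  then obtain \<rho> where \<rho>: "\<forall>x\<in>insert x\<^sub>0 V. norm x \<le> \<rho>"
    unfolding bounded_iff by blast
  obtain K where K: "K \<ge> 0" "\<And>x y. x \<in> cball 0 \<rho> \<Longrightarrow> y \<in> cball 0 \<rho> \<Longrightarrow> eh_dist t (range par) (par x) (par y) \<le> ennreal K"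
    using eh_dist_par_bounded[of "range par" \<rho>] by blast
  show ?thesis
  \<comment> \<open>8 is the volume of the cube V; adding 1 to K makes the distance bound
    strict.\<close>
  proof (rule that[of "e * 8" "K + 1"])
    fix R assume R: "R \<ge> K + 1"
    have "par ` V \<subseteq> eh_ball t (range par) (par x\<^sub>0) R"
    proof
      fix q assume "q \<in> par ` V"
      then obtain x where x: "x \<in> V" "q = par x" by blast
      have "eh_dist t (range par) (par x\<^sub>0) q \<le> ennreal K"
        unfolding x(2) using \<rho> x(1) by (intro K(2)) auto
      also have "\<dots> < ennreal R"
        using R K(1) by (intro ennreal_lessI) auto
      finally show "q \<in> eh_ball t (range par) (par x\<^sub>0) R"
        by (simp add: eh_ball_def x(2))
    qed
    moreover have "\<bar>x $ 1\<bar> < pi" if "x \<in> V" for x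
    proof -
      have "- 1 \<le> x $ 1 \<and> x $ 1 \<le> 1"
        using that by (simp add: V_def mem_box_cart)
      then show ?thesis
        using pi_gt3 by linarith
    qed
    moreover have "V \<in> sets borel"
      by (simp add: V_def)
    ultimately have "ennreal e * emeasure lborel V \<le> eh_volume t (range par) (eh_ball t (range par) (par x\<^sub>0) R)"
      using \<open>e > 0\<close> dens by (intro eh_volume_lower refl) auto
    then show "ennreal (e * 8) \<le> eh_volume t (range par) (eh_ball t (range par) (par x\<^sub>0) R)"
      using \<open>e > 0\<close> by (simp add: V ennreal_mult)
  qed (use \<open>e > 0\<close> in simp)
qed

lemma eh_exp_growth_zero: "eh_exp_growth t (range par) (par x\<^sub>0) = 0"
proof -
  obtain c\<^sub>0 R\<^sub>0 where c: "c\<^sub>0 > 0" "\<And>R. R \<ge> R\<^sub>0 \<Longrightarrow> ennreal c\<^sub>0 \<le> eh_volume t (range par) (eh_ball t (range par) (par x\<^sub>0) R)"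
    by (rule eh_volume_ball_lower[of x\<^sub>0]) blast
  define s where "s = sqrt (eh_S t (par x\<^sub>0))"
  define k where "k = 2 * (r * (1 + r\<^sup>2) / sqrt (2 * t\<^sup>2))"
  \<comment> \<open>Chosen so that the side 2 (2 pi + (s + R)^2) of the parameter cube is at most l
    (1 + R)^2, by s + R \<le> (s + 1)(1 + R). Cubing yields the exponent 6.\<close>
  define l where "l = 2 * (2 * pi + (s + 1)\<^sup>2)"
  have s: "s \<ge> 0"
    using eh_S_pos[OF t, of "par x\<^sub>0"] by (simp add: s_def)
  have k: "k > 0"
    using r t one_plus_r2 by (simp add: k_def)
  have l: "l > 0"
    unfolding l_def using pi_gt_zero by (intro mult_pos_pos add_pos_nonneg) auto
  show ?thesis
    unfolding eh_exp_growth_def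
  proof (rule growth_zero[OF c(1)])
    show "k * l ^ 3 > 0"
      using k l by simp
    show "\<forall>\<^sub>F R in at_top. ennreal c\<^sub>0 \<le> eh_volume t (range par) (eh_ball t (range par) (par x\<^sub>0) R)"
      using eventually_ge_at_top[of R\<^sub>0] by eventually_elim (rule c(2))
    show "\<forall>\<^sub>F R in at_top. eh_volume t (range par) (eh_ball t (range par) (par x\<^sub>0) R) \<le> ennreal (k * l ^ 3 * (1 + R) ^ 6)"
      using eventually_ge_at_top[of 0]
    proof eventually_elim
      fix R :: real assume R: "0 \<le> R"
      have "eh_volume t (range par) (eh_ball t (range par) (par x\<^sub>0) R) \<le> ennreal (k * (2 * (2 * pi + (s + R)\<^sup>2)) ^ 3)"
        unfolding k_def
        by (rule eh_volume_upper[OF refl]) (auto simp: eh_ball_def s_def intro!: eh_S_ball_bound[OF t _ R, where M = "range par"])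
      also have "\<dots> \<le> ennreal (k * (l * (1 + R)\<^sup>2) ^ 3)"
      proof (intro ennreal_leI mult_left_mono power_mono)
        have sR: "(s + R)\<^sup>2 \<le> ((s + 1) * (1 + R))\<^sup>2"
          using s R by (intro power_mono) (auto simp: algebra_simps)
        have "1 \<le> (1 + R)\<^sup>2"
          using R by (intro one_le_power) simp
        from mult_left_mono[OF this, of "2 * pi"] have piR: "2 * pi \<le> 2 * pi * (1 + R)\<^sup>2"
          by simp
        have "2 * (2 * pi + (s + R)\<^sup>2) \<le> 2 * (2 * pi * (1 + R)\<^sup>2 + ((s + 1) * (1 + R))\<^sup>2)"
          by (rule mult_left_mono[OF add_mono[OF piR sR]]) simp
        also have "\<dots> = l * (1 + R)\<^sup>2"
          unfolding l_def power_mult_distrib by algebra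
        finally show "2 * (2 * pi + (s + R)\<^sup>2) \<le> l * (1 + R)\<^sup>2" .
      qed (use k in auto)
      also have "k * (l * (1 + R)\<^sup>2) ^ 3 = k * l ^ 3 * (1 + R) ^ 6"
        by (simp add: power_mult_distrib flip: power_mult)
      finally show "eh_volume t (range par) (eh_ball t (range par) (par x\<^sub>0) R) \<le> ennreal (k * l ^ 3 * (1 + R) ^ 6)" .
    qed
  qed
qed

end

theorem proposition11:
  fixes t r\<^sub>0 :: real and \<Gamma> :: "complex option set"
  assumes "t > 0" and "r\<^sub>0 > 0" and "\<Gamma> = Some ` frontier (ball 0 r\<^sub>0)"
  shows "\<forall>A\<in>U2. \<forall>q\<^sub>0\<in>M3 (moebius A ` \<Gamma>). eh_exp_growth t (M3 (moebius A ` \<Gamma>)) q\<^sub>0 = 0"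
proof (intro ballI)
  fix A q\<^sub>0 assume A: "A \<in> U2" and q: "q\<^sub>0 \<in> M3 (moebius A ` \<Gamma>)"
  define a b c d where "a = A $ 1 $ 1" and "b = A $ 1 $ 2" and "c = A $ 2 $ 1" and "d = A $ 2 $ 2"
  have AA: "A = vector [vector [a, b], vector [c, d]]"
    by (simp add: vec_eq_iff forall_2 a_def b_def c_def d_def vector_2)
  have "A ** (\<chi> i j. cnj (A $ j $ i)) = mat 1" "(\<chi> i j. cnj (A $ j $ i)) ** A = mat 1"
    using A by (auto simp: U2_def)
  \<comment> \<open>The locale relations are entries of the identity A* A = 1, with A* the conjugate
    transpose: orthonormality of the columns.\<close>
  then interpret eh_circle r\<^sub>0 t a b c d
    using assms(1,2)
    by unfold_locales
       (simp_all add: vec_eq_iff forall_2 matrix_matrix_mult_def sum_2 mat_def a_def b_def c_def d_def mult.commute)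
  have "M3 (moebius A ` \<Gamma>) = range par"
    unfolding range_par_eq assms(3) AA using assms(2) by (simp add: image_image frontier_ball)
  then show "eh_exp_growth t (M3 (moebius A ` \<Gamma>)) q\<^sub>0 = 0"
    using q eh_exp_growth_zero by auto
qed

end
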